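(* Assume $M$ is a geodesic space. Let $\mu_0,\mu_1\in\mathcal{P}_L(M)$ and let $\pi_{opt}$ be an optimal coupling of $(\mu_0,\mu_1)$. Then there is a probability measure $\Pi$ supported on the geodesics $\mathrm{Geo}(M)$ such that $(e_i)_*\Pi=\mu_i$ for $i=0,1$ and, setting $\mu_t=(e_t)_*\Pi$, $$w_L(\mu_s,\mu_t)=|s-t|\,w_L(\mu_0,\mu_1)\qquad\text{for all }s,t\in[0,1].$$ In particular, $\mathcal{P}_L(M)$ is a geodesic space.
   Context: $(M,d)$ is a proper metric space. $L:[0,\infty)\to[0,\infty)$ is strictly convex and increasing with $L(0)=0$, $L(r)=\int_0^rl(s)\,ds$ with $l:(0,\infty)\to(0,\infty)$ increasing and $\lim_{r\to0}l(r)=0$. For $\lambda>0$, $L_\lambda(r)=L(r/\lambda)$. For probability measures $\mu_0,\mu_1$ on $M$, $$w_L(\mu_0,\mu_1)=\inf\Big\{\lambda>0\ :\ \inf_{\pi\in\Pi(\mu_0,\mu_1)}\int L_\lambda(d(x,y))\,d\pi(x,y)\le1\Big\},\qquad\inf\varnothing=\infty,$$ where $\Pi(\mu_0,\mu_1)$ is the set of couplings. $\mathcal{P}_L(M)=\{\mu\in\mathcal{P}(M):w_L(\mu,\delta_{x_0})<\infty\}$ for a fixed point $x_0$, with metric $w_L$. An optimal coupling $\pi_{opt}$ is a coupling with $\int L_{\lambda_{min}}(d(x,y))\,d\pi_{opt}(x,y)=1$ where $\lambda_{min}=w_L(\mu_0,\mu_1)$ (if $\lambda_{min}>0$). $\mathrm{Geo}(M)$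 is the space of constant speed minimal geodesics $\gamma:[0,1]\to M$, i.e. $d(\gamma_s,\gamma_t)=|s-t|d(\gamma_0,\gamma_1)$; $e_t(\gamma)=\gamma_t$. A metric space is geodesic if any two points are joined by a constant speed minimal geodesic. *)

theory Defs
  imports "HOL-Probability.Probability"
begin

definition strictly_convex_on :: "real set \<Rightarrow> (real \<Rightarrow> real) \<Rightarrow> bool" where
  "strictly_convex_on S f \<longleftrightarrow> convex S \<and>
    (\<forall>x\<in>S. \<forall>y\<in>S. \<forall>t\<in>{0<..<1}. x \<noteq> y \<longrightarrow> f ((1 - t) * x + t * y) < (1 - t) * f x + t * f y)"

text \<open>Constant speed minimal geodesics are functions on the unit interval, encoded as functions
  on the reals that are undefined outside of it.\<close>

definition Geo :: "'b set \<Rightarrow> ('b \<Rightarrow> 'b \<Rightarrow> real) \<Rightarrow> (real \<Rightarrow> 'b) set" where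
  "Geo X d = {\<gamma> \<in> {0..1} \<rightarrow>\<^sub>E X. \<forall>s\<in>{0..1}. \<forall>t\<in>{0..1}. d (\<gamma> s) (\<gamma> t) = \<bar>s - t\<bar> * d (\<gamma> 0) (\<gamma> 1)}"

definition geodesic_space :: "'b set \<Rightarrow> ('b \<Rightarrow> 'b \<Rightarrow> real) \<Rightarrow> bool" where
  "geodesic_space X d \<longleftrightarrow> Metric_space X d \<and> (\<forall>x\<in>X. \<forall>y\<in>X. \<exists>\<gamma>\<in>Geo X d. \<gamma> 0 = x \<and> \<gamma> 1 = y)"

text \<open>The space of geodesics of the ambient type carries the uniform distance and the
  corresponding Borel sets.\<close>

definition Geo_metric :: "(real \<Rightarrow> 'a::metric_space) metric" where
  "Geo_metric = submetric (cfunspace (top_of_set {0..1}) euclidean_metric) (Geo UNIV dist)"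

definition Geo_borel :: "(real \<Rightarrow> 'a::metric_space) measure" where
  "Geo_borel = sigma (Geo UNIV dist) {U. openin (mtopology_of Geo_metric) U}"

lemma Geo_isometry:
  assumes "\<gamma> \<in> Geo UNIV dist" "s \<in> {0..1}" "t \<in> {0..1}"
  shows "dist (\<gamma> s) (\<gamma> t) = \<bar>s - t\<bar> * dist (\<gamma> 0) (\<gamma> 1)"
  using assms unfolding Geo_def by blast

lemma continuous_on_Geo:
  assumes "\<gamma> \<in> Geo UNIV dist"
  shows "continuous_on {0..1} \<gamma>"
proof -
  have "(dist (\<gamma> 0) (\<gamma> 1))-lipschitz_on {0..1} \<gamma>"
  proof (rule lipschitz_onI)
    fix s t :: real
    assume "s \<in> {0..1}" "t \<in> {0..1}"
    then show "dist (\<gamma> s) (\<gamma> t) \<le> dist (\<gamma> 0) (\<gamma> 1) * dist s t"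
      unfolding Geo_isometry[OF assms \<open>s \<in> {0..1}\<close> \<open>t \<in> {0..1}\<close>] dist_real_def
      by (simp only: mult.commute order_refl)
  qed simp
  then show ?thesis
    by (rule lipschitz_on_continuous_on)
qed

lemma mspace_Geo_metric: "mspace Geo_metric = (Geo UNIV dist :: (real \<Rightarrow> 'a::metric_space) set)"
proof -
  have "\<gamma> \<in> mspace (cfunspace (top_of_set {0..1}) euclidean_metric)"
    if \<gamma>: "\<gamma> \<in> Geo UNIV dist" for \<gamma> :: "real \<Rightarrow> 'a"
  proof -
    have cont: "continuous_on {0..1} \<gamma>"
      by (rule continuous_on_Geo[OF \<gamma>])
    then have "bounded (\<gamma> ` {0..1})"
      by (intro compact_imp_bounded compact_continuous_image) auto
    moreover have "mtopology_of (euclidean_metric :: 'a metric) = euclidean"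
      by (simp add: mtopology_of_def mtopology_is_euclidean)
    moreover have "\<gamma> \<in> extensional {0..1}"
      using \<gamma> unfolding Geo_def PiE_def by blast
    ultimately show ?thesis
      using cont by (simp add: cfunspace_def Met_TC.fspace_def)
  qed
  then show ?thesis
    by (auto simp: Geo_metric_def)
qed

lemma Geo_open_subset:
  "{U. openin (mtopology_of Geo_metric) U} \<subseteq> Pow (Geo UNIV dist :: (real \<Rightarrow> 'a::metric_space) set)"
  using openin_subset[of "mtopology_of (Geo_metric :: (real \<Rightarrow> 'a) metric)"]
  by (auto simp: mspace_Geo_metric)

lemma space_Geo_borel: "space Geo_borel = Geo UNIV dist"
  by (simp add: Geo_borel_def Geo_open_subset)

lemma sets_Geo_borel:
  "sets Geo_borel = sigma_sets (Geo UNIV dist) {U. openin (mtopology_of Geo_metric) U}"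
  by (simp add: Geo_borel_def Geo_open_subset)

lemma measurable_Geo_eval:
  assumes "t \<in> {0..1}"
  shows "(\<lambda>\<gamma>. \<gamma> t) \<in> Geo_borel \<rightarrow>\<^sub>M (borel :: 'a::metric_space measure)"
proof (rule borel_measurableI)
  fix S :: "'a set"
  assume "open S"
  interpret G: Metric_space "Geo UNIV dist :: (real \<Rightarrow> 'a) set" "mdist Geo_metric"
    using Metric_space_mspace_mdist[of Geo_metric] by (simp add: mspace_Geo_metric)
  have ev_le: "dist (\<gamma> t) (\<eta> t) \<le> mdist Geo_metric \<gamma> \<eta>"
    if "\<gamma> \<in> Geo UNIV dist" "\<eta> \<in> Geo UNIV dist" for \<gamma> \<eta> :: "real \<Rightarrow> 'a"
  proof -
    let ?F = "funspace {0..1::real} (euclidean_metric :: 'a metric)"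
    have "\<gamma> \<in> mspace ?F" "\<eta> \<in> mspace ?F"
      using that unfolding mspace_Geo_metric[symmetric] by (auto simp: Geo_metric_def cfunspace_def)
    then have "dist (\<gamma> t) (\<eta> t) \<le> mdist ?F \<gamma> \<eta>"
      using funspace_mdist_le[of \<gamma> "{0..1}" "euclidean_metric :: 'a metric" \<eta> "mdist ?F \<gamma> \<eta>"] assms
      by (auto simp del: mdist_funspace mspace_funspace)
    then show ?thesis
      by (simp add: Geo_metric_def cfunspace_def)
  qed
  have "openin G.mtopology ((\<lambda>\<gamma>. \<gamma> t) -` S \<inter> Geo UNIV dist)"
    unfolding G.openin_mtopology
  proof (intro conjI allI impI)
    fix \<gamma> assume \<gamma>: "\<gamma> \<in> (\<lambda>\<gamma>. \<gamma> t) -` S \<inter> Geo UNIV dist"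
    then obtain e where e: "e > 0" "ball (\<gamma> t) e \<subseteq> S"
      using \<open>open S\<close> by (auto elim: openE)
    have "G.mball \<gamma> e \<subseteq> (\<lambda>\<gamma>. \<gamma> t) -` S \<inter> Geo UNIV dist"
    proof
      fix \<eta> assume "\<eta> \<in> G.mball \<gamma> e"
      then have "\<eta> \<in> Geo UNIV dist" "mdist Geo_metric \<gamma> \<eta> < e"
        by auto
      then show "\<eta> \<in> (\<lambda>\<gamma>. \<gamma> t) -` S \<inter> Geo UNIV dist"
        using ev_le[of \<gamma> \<eta>] \<gamma> e by (auto intro!: subsetD[OF e(2)])
    qed
    then show "\<exists>r>0. G.mball \<gamma> r \<subseteq> (\<lambda>\<gamma>. \<gamma> t) -` S \<inter> Geo UNIV dist"
      using e by blast
  qed auto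
  moreover have "mtopology_of Geo_metric = G.mtopology"
    by (simp add: mtopology_of_def mspace_Geo_metric)
  ultimately show "(\<lambda>\<gamma>. \<gamma> t) -` S \<inter> space Geo_borel \<in> sets Geo_borel"
    by (simp add: space_Geo_borel sets_Geo_borel)
qed

text \<open>A proper metric space (class \<open>heine_borel\<close>) is second countable, so the product sigma-algebra
  below coincides with the Borel sets of the product.\<close>

definition couplings :: "'a::topological_space measure \<Rightarrow> 'a measure \<Rightarrow> ('a \<times> 'a) measure set" where
  "couplings \<mu> \<nu> = {\<pi> \<in> space (prob_algebra (borel \<Otimes>\<^sub>M borel)).
    distr \<pi> borel fst = \<mu> \<and> distr \<pi> borel snd = \<nu>}"

text \<open>The cost of a coupling for the rescaled function \<open>L\<^sub>c(r) = L(r / c)\<close>.\<close>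

definition transport_cost :: "(real \<Rightarrow> real) \<Rightarrow> real \<Rightarrow> ('a::metric_space \<times> 'a) measure \<Rightarrow> ennreal" where
  "transport_cost L c \<pi> = (\<integral>\<^sup>+ p. ennreal (L (dist (fst p) (snd p) / c)) \<partial>\<pi>)"

definition w_L :: "(real \<Rightarrow> real) \<Rightarrow> 'a::metric_space measure \<Rightarrow> 'a measure \<Rightarrow> ennreal" where
  "w_L L \<mu> \<nu> = Inf (ennreal ` {c. c > 0 \<and> (INF \<pi>\<in>couplings \<mu> \<nu>. transport_cost L c \<pi>) \<le> 1})"

text \<open>\<open>w_L\<close> takes extended values, with the empty infimum being \<open>\<infinity>\<close>. On \<open>P_L\<close> it is finite, and
  its real-valued version \<open>w_L_dist\<close> is the metric; elsewhere \<open>enn2real\<close> sends \<open>\<infinity>\<close> to 0.\<close>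

definition w_L_dist :: "(real \<Rightarrow> real) \<Rightarrow> 'a::metric_space measure \<Rightarrow> 'a measure \<Rightarrow> real" where
  "w_L_dist L \<mu> \<nu> = enn2real (w_L L \<mu> \<nu>)"

definition P_L :: "(real \<Rightarrow> real) \<Rightarrow> 'a::metric_space \<Rightarrow> 'a measure set" where
  "P_L L x\<^sub>0 = {\<mu> \<in> space (prob_algebra borel). w_L L \<mu> (return borel x\<^sub>0) < \<infinity>}"

text \<open>The normalisation is only demanded when the distance is positive; for measures at
  distance zero every coupling qualifies.\<close>

definition optimal_coupling ::
    "(real \<Rightarrow> real) \<Rightarrow> 'a::metric_space measure \<Rightarrow> 'a measure \<Rightarrow> ('a \<times> 'a) measure \<Rightarrow> bool" where
  "optimal_coupling L \<mu> \<nu> \<pi> \<longleftrightarrow> \<pi> \<in> couplings \<mu> \<nu> \<and>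
    (w_L L \<mu> \<nu> > 0 \<longrightarrow> transport_cost L (enn2real (w_L L \<mu> \<nu>)) \<pi> = 1)"

end

theory Submission
  imports Defs
begin

text \<open>A limit of almost optimal couplings of \<open>\<mu>\<^sub>0\<close> and \<open>\<mu>\<^sub>1\<close> has cost at most 1 at every scale
  \<open>c > w\<^sub>L(\<mu>\<^sub>0, \<mu>\<^sub>1)\<close>. Let \<open>\<Theta>\<close> be its image under a measurable choice of geodesics. The pair
  \<open>(e\<^sub>s, e\<^sub>t)\<close> then couples \<open>\<mu>\<^sub>s\<close> and \<open>\<mu>\<^sub>t\<close>, and as \<open>d(\<gamma>\<^sub>s, \<gamma>\<^sub>t) = \<bar>s - t\<bar> d(\<gamma>\<^sub>0, \<gamma>\<^sub>1)\<close> its cost at scale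
  \<open>\<bar>s - t\<bar> c\<close> is the cost of the original coupling at scale \<open>c\<close>; hence
  \<open>w\<^sub>L(\<mu>\<^sub>s, \<mu>\<^sub>t) \<le> \<bar>s - t\<bar> w\<^sub>L(\<mu>\<^sub>0, \<mu>\<^sub>1)\<close>, and the triangle inequality forces equality. That inequality
  holds because couplings can be glued over the cells of a fine countable partition, up to an error
  that the convexity of \<open>L\<close> absorbs, so that no disintegration is needed.\<close>

section \<open>Measurable choice of geodesics\<close>

text \<open>Geodesics between two points need not be unique, and two topologies on paths compete.
  Compactness of sets of geodesics comes from Tychonoff's theorem, so the selection lives in the
  product topology on \<open>real \<Rightarrow> 'a\<close>, whereas \<open>Geo_borel\<close> comes
  from the uniform distance; constant speed makes every uniformly open subset of \<open>Geo\<close>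
  the trace of a product open set, which closes the gap. The limit coupling is built from limits of
  the masses of all sets at once. These are in general uncountably many, so the limit runs along a
  filter finer than \<open>sequentially\<close> instead of a subsequence. Working at scales strictly
  above the distance treats distance zero uniformly: at scale 0 itself the convention
  \<open>x / 0 = 0\<close> would make every cost vanish. In the triangle inequality the two
  couplings meet only in a common cell, which leaves a gap between the two middle points. The gap
  becomes a third leg with its own scale \<open>\<delta>\<close>: if the cells are so small that
  this leg costs at most 1, the weighted costs at scale \<open>c1 + \<delta> + c2\<close> sum to at
  most 1.\<close>

lemma heine_borel_countable_basis: "\<exists>B :: 'a::heine_borel set set. countable B \<and> topological_basis B"
proof -
  fix o' :: 'a
  \<comment> \<open>Properness makes closed balls compact, so for each radius \<open>n\<close> and
    mesh \<open>1 / real (Suc m)\<close> there is a finite net. The small balls about all these nets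
    together form the basis.\<close>
  have "\<exists>D. finite D \<and> cball o' (real n) \<subseteq> (\<Union>x\<in>D. ball x (1 / real (Suc m)))" for n m
  proof -
    have "compact (cball o' (real n))" by (simp add: compact_eq_bounded_closed)
    moreover have "cball o' (real n) \<subseteq> (\<Union>x\<in>cball o' (real n). ball x (1 / real (Suc m)))"
      by force
    ultimately obtain D where "D \<subseteq> cball o' (real n)" "finite D" "cball o' (real n) \<subseteq> (\<Union>x\<in>D. ball x (1 / real (Suc m)))"
      using compactE_image[of "cball o' (real n)" "cball o' (real n)" "\<lambda>x. ball x (1 / real (Suc m))"]
      by (metis open_ball)
    then show ?thesis by blast
  qed
  then obtain D where fin: "\<And>n m. finite (D n m)"
    and cov: "\<And>n m. cball o' (real n) \<subseteq> (\<Union>x\<in>D n m. ball x (1 / real (Suc m)))"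
    by metis
  define B where "B = (\<Union>n m. (\<lambda>x. ball x (1 / real (Suc m))) ` D n m)"
  have "countable B"
    unfolding B_def by (simp add: countable_finite fin)
  moreover have "topological_basis B"
  proof (rule topological_basisI)
    fix U :: "'a set" and x assume "open U" "x \<in> U"
    then obtain e where e: "e > 0" "ball x e \<subseteq> U" by (auto elim: openE)
    obtain m where m: "1 / real (Suc m) < e / 2"
      using e nat_approx_posE[of "e/2"] by auto
    obtain n where n: "dist o' x \<le> real n" using real_arch_simple by blast
    then obtain y where y: "y \<in> D n m" "dist y x < 1 / real (Suc m)" using cov[of n m] by auto
    have "ball y (1 / real (Suc m)) \<subseteq> ball x e"
    proof
      fix z assume "z \<in> ball y (1 / real (Suc m))"
      then have "dist x z < 1 / real (Suc m) + 1 / real (Suc m)"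
        using y(2) dist_triangle[of x z y] by (simp add: dist_commute)
      then show "z \<in> ball x e" using m by simp
    qed
    then show "\<exists>B'\<in>B. x \<in> B' \<and> B' \<subseteq> U"
      using y e unfolding B_def by (intro bexI[of _ "ball y (1 / real (Suc m))"]) auto
  qed (auto simp: B_def)
  ultimately show ?thesis by blast
qed

instance heine_borel \<subseteq> second_countable_topology
proof
  show "\<exists>B :: 'a set set. countable B \<and> open = generate_topology B"
    using heine_borel_countable_basis topological_basis_imp_subbasis by blast
qed

text \<open>Completeness and separability together make inner regularity by compact sets available;
  the limits of couplings rest on it.\<close>

instance heine_borel \<subseteq> polish_space ..

text \<open>The selection minimises \<open>\<phi> 0, \<phi> 1, \<dots>\<close> lexicographically. The minimisers of \<open>\<phi> n\<close> on a
  compact set \<open>K p\<close> meet a closed set \<open>C\<close> if and only if for every rational \<open>r\<close>, whenever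
  \<open>{y \<in> K p. \<phi> n y \<le> r}\<close> is nonempty it meets \<open>C\<close>; this keeps measurability along the way.\<close>

lemma compact_valued_measurable_selection:
  fixes K :: "'p \<Rightarrow> 'y::topological_space set" and \<phi> :: "nat \<Rightarrow> 'y \<Rightarrow> real"
  assumes cpt: "\<And>p. p \<in> space M \<Longrightarrow> compact (K p)"
    and clo: "\<And>p. p \<in> space M \<Longrightarrow> closed (K p)"
    and ne: "\<And>p. p \<in> space M \<Longrightarrow> K p \<noteq> {}"
    and cont: "\<And>n. continuous_on UNIV (\<phi> n)"
    and sep: "\<And>p x y. p \<in> space M \<Longrightarrow> x \<in> K p \<Longrightarrow> y \<in> K p \<Longrightarrow> (\<And>n. \<phi> n x = \<phi> n y) \<Longrightarrow> x = y"
    and meas: "\<And>C. closed C \<Longrightarrow> {p \<in> space M. K p \<inter> C \<noteq> {}} \<in> sets M"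
  shows "\<exists>f \<in> borel_measurable M. \<forall>p\<in>space M. f p \<in> K p"
proof -
  define \<kappa> where "\<kappa> = rec_nat K (\<lambda>n k p. {y \<in> k p. \<forall>z\<in>k p. \<phi> n y \<le> \<phi> n z})"
  have \<kappa>0: "\<kappa> 0 = K" and \<kappa>S: "\<And>n p. \<kappa> (Suc n) p = {y \<in> \<kappa> n p. \<forall>z\<in>\<kappa> n p. \<phi> n y \<le> \<phi> n z}"
    by (simp_all add: \<kappa>_def)
  have closed_le: "closed {y. \<phi> n y \<le> r}" for n r
    by (intro closed_Collect_le cont continuous_on_const)
  have cn: "compact (\<kappa> n p) \<and> closed (\<kappa> n p) \<and> \<kappa> n p \<noteq> {}" if "p \<in> space M" for n p
  proof (induction n)
    case 0
    then show ?case using cpt clo ne that by (simp add: \<kappa>0)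
  next
    case (Suc n)
    have "\<exists>y\<in>\<kappa> n p. \<forall>z\<in>\<kappa> n p. \<phi> n y \<le> \<phi> n z"
      using Suc continuous_on_subset[OF cont] by (intro continuous_attains_inf) auto
    then obtain y where y: "y \<in> \<kappa> n p" "\<forall>z\<in>\<kappa> n p. \<phi> n y \<le> \<phi> n z" by blast
    then have eq: "\<kappa> (Suc n) p = \<kappa> n p \<inter> {z. \<phi> n z \<le> \<phi> n y}"
      unfolding \<kappa>S by (auto intro: order_trans)
    then show ?case
      using Suc y closed_le[of n "\<phi> n y"] by (auto intro: compact_Int_closed)
  qed
  have mn: "{p \<in> space M. \<kappa> n p \<inter> C \<noteq> {}} \<in> sets M" if "closed C" for n C
    using that
  proof (induction n arbitrary: C)
    case 0
    then show ?case using meas by (simp add: \<kappa>0)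
  next
    case (Suc n)
    have iff: "\<kappa> (Suc n) p \<inter> C \<noteq> {} \<longleftrightarrow>
       (\<forall>r\<in>\<rat>. \<kappa> n p \<inter> {y. \<phi> n y \<le> r} \<noteq> {} \<longrightarrow> \<kappa> n p \<inter> (C \<inter> {y. \<phi> n y \<le> r}) \<noteq> {})" (is "_ \<longleftrightarrow> ?R")
      if p: "p \<in> space M" for p
    proof
      assume "\<kappa> (Suc n) p \<inter> C \<noteq> {}"
      then obtain y where "y \<in> \<kappa> n p" "y \<in> C" "\<forall>z\<in>\<kappa> n p. \<phi> n y \<le> \<phi> n z" unfolding \<kappa>S by blast
      then show ?R by (blast intro: order_trans)
    next
      assume R: ?R
      obtain y0 where y0: "y0 \<in> \<kappa> n p" "\<And>z. z \<in> \<kappa> n p \<Longrightarrow> \<phi> n y0 \<le> \<phi> n z"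
        using cn[OF p, of "Suc n"] unfolding \<kappa>S by blast
      \<comment> \<open>Levels strictly above the minimum have nonempty sublevel sets, so the
        premise of the condition holds for them.\<close>
      have C_hit: "\<kappa> n p \<inter> (C \<inter> {y. \<phi> n y \<le> r}) \<noteq> {}" if "r \<in> \<rat>" "\<phi> n y0 < r" for r
        using R that y0(1) less_imp_le[OF that(2)] by blast
      obtain r where "r \<in> \<rat>" "\<phi> n y0 < r" using Rats_dense_in_real[of "\<phi> n y0" "\<phi> n y0 + 1"] by auto
      then have "\<kappa> n p \<inter> C \<noteq> {}" using C_hit by blast
      moreover have "compact (\<kappa> n p \<inter> C)" using cn[OF p] Suc.prems by (auto intro: compact_Int_closed)
      ultimately obtain y1 where y1: "y1 \<in> \<kappa> n p \<inter> C" "\<And>z. z \<in> \<kappa> n p \<inter> C \<Longrightarrow> \<phi> n y1 \<le> \<phi> n z"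
        using continuous_attains_inf[of "\<kappa> n p \<inter> C" "\<phi> n"] continuous_on_subset[OF cont] by auto
      \<comment> \<open>If the minimum over \<open>C\<close> were larger, a rational level strictly
        between the two minima would have a nonempty sublevel set that misses
        \<open>C\<close>.\<close>
      have "\<phi> n y1 \<le> \<phi> n y0"
      proof (rule ccontr)
        assume "\<not> ?thesis"
        then obtain r where r: "r \<in> \<rat>" "\<phi> n y0 < r" "r < \<phi> n y1"
          using Rats_dense_in_real[of "\<phi> n y0" "\<phi> n y1"] by auto
        then obtain z where "z \<in> \<kappa> n p \<inter> C" "\<phi> n z \<le> r" using C_hit by blast
        then show False using y1(2)[of z] r by simp
      qed
      then show "\<kappa> (Suc n) p \<inter> C \<noteq> {}"
        using y0 y1 unfolding \<kappa>S by (blast intro: order_trans)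
    qed
    have "{p \<in> space M. \<kappa> (Suc n) p \<inter> C \<noteq> {}} =
      {p \<in> space M. \<forall>r\<in>\<rat>. \<kappa> n p \<inter> {y. \<phi> n y \<le> r} \<noteq> {} \<longrightarrow> \<kappa> n p \<inter> (C \<inter> {y. \<phi> n y \<le> r}) \<noteq> {}}"
      by (rule Collect_cong) (simp add: iff cong: conj_cong)
    moreover have "\<dots> \<in> sets M"
      by (rule sets.sets_Collect_countable_All'[OF sets.sets_Collect_imp[OF
            Suc.IH[OF closed_Int[OF Suc.prems closed_le]] Suc.IH[OF closed_le]] countable_rat])
    ultimately show ?case by simp
  qed
  \<comment> \<open>Cantor's intersection argument: the sets \<open>\<kappa> n p\<close> decrease
    and are compact, so a closed set met by each of them is met by their intersection. This carries
    measurability from the stages to the limit.\<close>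
  have hit: "(\<Inter>n. \<kappa> n p) \<inter> C \<noteq> {}" if p: "p \<in> space M" and C: "closed C" "\<And>n. \<kappa> n p \<inter> C \<noteq> {}" for p C
  proof -
    have dec: "\<kappa> n p \<subseteq> \<kappa> m p" if "m \<le> n" for m n
      using that by (rule lift_Suc_antimono_le[rotated]) (auto simp: \<kappa>S)
    have "(K p \<inter> C) \<inter> (\<Inter>n\<in>UNIV. \<kappa> n p) \<noteq> {}"
    proof (rule compact_imp_fip_image)
      show "compact (K p \<inter> C)" using cpt p C by (auto intro: compact_Int_closed)
      fix I' :: "nat set" assume "finite I'"
      then have "\<kappa> (Max (insert 0 I')) p \<subseteq> (K p \<inter> (\<Inter>i\<in>I'. \<kappa> i p))"
        using dec[of 0 "Max (insert 0 I')"] dec[of _ "Max (insert 0 I')"]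
        by (intro Int_greatest INT_greatest) (simp_all add: \<kappa>0)
      then show "K p \<inter> C \<inter> (\<Inter>i\<in>I'. \<kappa> i p) \<noteq> {}"
        using C(2)[of "Max (insert 0 I')"] by blast
    qed (use cn[OF p] in auto)
    then show ?thesis by blast
  qed
  have "\<exists>y. y \<in> (\<Inter>n. \<kappa> n p)" if "p \<in> space M" for p
    using hit[OF that, of UNIV] cn[OF that] by auto
  then obtain f where f: "\<And>p n. p \<in> space M \<Longrightarrow> f p \<in> \<kappa> n p" by (metis INT_E UNIV_I)
  \<comment> \<open>Every \<open>\<phi> n\<close> is constant on \<open>\<kappa> (Suc n) p\<close>,
    so \<open>sep\<close> leaves a single point in the intersection.\<close>
  have uniq: "y = f p" if p: "p \<in> space M" and y: "\<And>n. y \<in> \<kappa> n p" for p y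
  proof (rule sep[OF p])
    show "y \<in> K p" "f p \<in> K p" using y[of 0] f[OF p, of 0] by (simp_all add: \<kappa>0)
    show "\<phi> n y = \<phi> n (f p)" for n
      using y[of "Suc n"] f[OF p, of "Suc n"] unfolding \<kappa>S by (auto intro!: antisym)
  qed
  have "f \<in> borel_measurable M"
  proof (rule borel_measurableI)
    fix S :: "'y set" assume "open S"
    then have C: "closed (- S)" by (simp add: closed_Compl)
    have "f p \<in> - S \<longleftrightarrow> (\<forall>n. \<kappa> n p \<inter> - S \<noteq> {})" if p: "p \<in> space M" for p
    proof
      show "f p \<in> - S \<Longrightarrow> \<forall>n. \<kappa> n p \<inter> - S \<noteq> {}" using f[OF p] by blast
      assume "\<forall>n. \<kappa> n p \<inter> - S \<noteq> {}"
      then obtain y where "y \<in> (\<Inter>n. \<kappa> n p)" "y \<in> - S" using hit[OF p C] by blast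
      then show "f p \<in> - S" using uniq[OF p, of y] by auto
    qed
    then have "f -` S \<inter> space M = space M - {p \<in> space M. \<forall>n. p \<in> {p \<in> space M. \<kappa> n p \<inter> - S \<noteq> {}}}"
      by auto
    moreover have "\<dots> \<in> sets M"
      using mn[OF C] by (intro sets.Diff sets.top sets.sets_Collect_countable_All) (auto simp: Int_def conj_commute)
    ultimately show "f -` S \<inter> space M \<in> sets M" by simp
  qed
  moreover have "f p \<in> K p" if "p \<in> space M" for p using f[OF that, of 0] by (simp add: \<kappa>0)
  ultimately show ?thesis by blast
qed

text \<open>A geodesic is Lipschitz with constant the distance of its ends, so closeness to
  \<open>\<gamma>\<close> at finitely many times, the ends included, already bounds the uniform
  distance. This lets a selection that is Borel for the product topology be measurable into
  \<open>Geo_borel\<close>.\<close>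

lemma openin_Geo_metric_imp_product_open:
  fixes U :: "(real \<Rightarrow> 'a::metric_space) set"
  assumes U: "openin (mtopology_of Geo_metric) U"
  shows "\<exists>V. open V \<and> U = V \<inter> Geo UNIV dist"
proof -
  interpret G: Metric_space "Geo UNIV dist :: (real \<Rightarrow> 'a) set" "mdist Geo_metric"
    using Metric_space_mspace_mdist[of Geo_metric] by (simp add: mspace_Geo_metric)
  have top: "mtopology_of (Geo_metric :: (real \<Rightarrow> 'a) metric) = G.mtopology"
    by (simp add: mtopology_of_def mspace_Geo_metric)
  have "\<exists>V. open V \<and> \<gamma> \<in> V \<and> V \<inter> Geo UNIV dist \<subseteq> U" if "\<gamma> \<in> U" for \<gamma>
  proof -
    from U[unfolded top G.openin_mtopology] that obtain e where e: "e > 0" "G.mball \<gamma> e \<subseteq> U"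
      and \<gamma>: "\<gamma> \<in> Geo UNIV dist" by blast
    define len where "len = dist (\<gamma> 0) (\<gamma> 1)"
    \<comment> \<open>The grid is so fine that \<open>\<gamma>\<close> moves by at most
      \<open>e / 8\<close> between neighbouring grid times.\<close>
    obtain n0 where n0: "8 * len / e < real n0" using reals_Archimedean2 by blast
    define n where "n = Suc n0"
    have n: "n > 0" "len / n \<le> e / 8"
      using n0 e by (simp_all add: n_def field_simps)
    define V where "V = (\<Inter>k\<in>{..n}. (\<lambda>\<eta> :: real \<Rightarrow> 'a. \<eta> (real k / n)) -` ball (\<gamma> (real k / n)) (e / 8))"
    have "open V" unfolding V_def
      by (intro open_INT ballI open_vimage continuous_on_product_coordinates) auto
    moreover have "\<gamma> \<in> V" using e by (auto simp: V_def)
    moreover have "\<eta> \<in> U" if "\<eta> \<in> V" and \<eta>: "\<eta> \<in> Geo UNIV dist" for \<eta>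
    proof -
      have near: "dist (\<gamma> (real k / n)) (\<eta> (real k / n)) < e / 8" if "k \<le> n" for k
        using \<open>\<eta> \<in> V\<close> that unfolding V_def by auto
      have "dist (\<gamma> 0) (\<eta> 0) < e / 8" "dist (\<gamma> 1) (\<eta> 1) < e / 8" using near[of 0] near[of n] n by auto
      then have \<eta>_len: "dist (\<eta> 0) (\<eta> 1) \<le> len + e / 4"
        using dist_triangle[of "\<eta> 0" "\<eta> 1" "\<gamma> 0"] dist_triangle[of "\<gamma> 0" "\<eta> 1" "\<gamma> 1"]
        by (simp add: len_def dist_commute)
      \<comment> \<open>The bound adds \<open>e / 8\<close> for the motion of
        \<open>\<gamma>\<close> to the grid time, \<open>e / 8\<close> for the gap there, and
        \<open>e / 8 + e / 4\<close> for the motion of \<open>\<eta>\<close>, whose ends may be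
        \<open>e / 4\<close> farther apart.\<close>
      have close: "dist (\<gamma> t) (\<eta> t) \<le> 5 * e / 8" if t: "t \<in> {0..1}" for t
      proof -
        define k where "k = nat \<lfloor>t * n\<rfloor>"
        have k1: "real k \<le> t * n" "t * n \<le> real k + 1" unfolding k_def using t n by (auto simp: of_nat_nat)
        have "t * n \<le> n" using t n by (simp add: mult_left_le_one_le)
        then have kn: "k \<le> n" using k1 by linarith
        then have kt: "real k / n \<in> {0..1}" using n by auto
        have abs: "\<bar>t - real k / n\<bar> \<le> 1 / n"
        proof -
          have "t - real k / n = (t * n - real k) / n" using n by (simp add: diff_divide_distrib)
          then show ?thesis using k1 by (simp add: divide_right_mono)
        qed
        have "dist (\<gamma> t) (\<gamma> (real k / n)) \<le> 1 / n * len"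
          unfolding Geo_isometry[OF \<gamma> t kt] len_def by (intro mult_right_mono abs) simp
        moreover have "dist (\<eta> (real k / n)) (\<eta> t) \<le> 1 / n * (len + e / 4)"
          unfolding Geo_isometry[OF \<eta> kt t] using abs \<eta>_len
          by (intro mult_mono) (auto simp: abs_minus_commute)
        moreover have "1 / n * (e / 4) \<le> e / 4" using n e by (simp add: field_simps)
        ultimately show ?thesis
          using near[OF kn] n(2) dist_triangle[of "\<gamma> t" "\<eta> t" "\<gamma> (real k / n)"]
            dist_triangle[of "\<gamma> (real k / n)" "\<eta> t" "\<eta> (real k / n)"] e
          by (simp add: distrib_left)
      qed
      have "mdist Geo_metric \<gamma> \<eta> \<le> 5 * e / 8"
        unfolding Geo_metric_def mdist_submetric
        by (rule mdist_cfunspace_le) (use e close in auto)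
      then show ?thesis using e \<gamma> \<eta> by (intro subsetD[OF e(2)]) auto
    qed
    ultimately show ?thesis by blast
  qed
  then obtain V where V: "\<And>\<gamma>. \<gamma> \<in> U \<Longrightarrow> open (V \<gamma>) \<and> \<gamma> \<in> V \<gamma> \<and> V \<gamma> \<inter> Geo UNIV dist \<subseteq> U" by metis
  have "U \<subseteq> Geo UNIV dist" using openin_subset[OF U[unfolded top]] by simp
  with V show ?thesis by (intro exI[of _ "\<Union>\<gamma>\<in>U. V \<gamma>"]) blast
qed

lemma continuous_on_eval [continuous_intros]:
  "continuous_on S (\<lambda>\<gamma> :: 'i \<Rightarrow> 'b::topological_space. \<gamma> t)"
  by (rule continuous_on_subset[OF continuous_on_product_coordinates]) simp

text \<open>Each defining condition, including the value \<open>undefined\<close> outside the unit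
  interval, is an equation between continuous functions of finitely many evaluations.\<close>

lemma closed_Geo: "closed (Geo UNIV dist :: (real \<Rightarrow> 'a::metric_space) set)"
proof -
  have "Geo UNIV dist = (\<Inter>t\<in>-{0..1}. {\<gamma> :: real \<Rightarrow> 'a. \<gamma> t = undefined}) \<inter>
     (\<Inter>s\<in>{0..1}. \<Inter>t\<in>{0..1}. {\<gamma>. dist (\<gamma> s) (\<gamma> t) = \<bar>s - t\<bar> * dist (\<gamma> 0) (\<gamma> 1)})"
    by (auto simp: Geo_def PiE_def extensional_def)
  also have "closed \<dots>"
    by (intro closed_Int closed_INT ballI closed_Collect_eq continuous_intros)
  finally show ?thesis .
qed

text \<open>Tychonoff: a geodesic with both ends in \<open>cball a R\<close> stays within
  \<open>2 * R\<close> of its start, hence in \<open>cball a (3 * R)\<close>, which is compact by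
  properness. Outside the unit interval the factor is a single point.\<close>

lemma compact_Geo_bounded_ends:
  fixes a :: "'a::heine_borel"
  shows "compact {\<gamma> \<in> Geo UNIV dist. \<gamma> 0 \<in> cball a R \<and> \<gamma> 1 \<in> cball a R}" (is "compact ?G")
proof -
  define S where "S t = (if t \<in> {0..1::real} then cball a (3 * R) else {undefined})" for t
  have "compactin (product_topology (\<lambda>i. euclidean) UNIV) (PiE UNIV S)"
    unfolding compactin_PiE by (auto simp: S_def compactin_euclidean_iff compact_eq_bounded_closed)
  then have "compact (PiE UNIV S)"
    unfolding euclidean_product_topology compactin_euclidean_iff .
  moreover have "closed ?G"
  proof -
    have "?G = Geo UNIV dist \<inter> {\<gamma>. dist a (\<gamma> 0) \<le> R} \<inter> {\<gamma>. dist a (\<gamma> 1) \<le> R}" by auto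
    also have "closed \<dots>"
      by (intro closed_Int closed_Geo closed_Collect_le continuous_intros)
    finally show ?thesis .
  qed
  moreover have "?G \<subseteq> PiE UNIV S"
  proof
    fix \<gamma> assume \<gamma>: "\<gamma> \<in> ?G"
    have "\<gamma> t \<in> S t" for t
    proof (cases "t \<in> {0..1}")
      case True
      have "dist (\<gamma> 0) (\<gamma> 1) \<le> 2 * R"
        using \<gamma> dist_triangle2[of "\<gamma> 0" "\<gamma> 1" a] by (auto simp: dist_commute)
      then have "dist (\<gamma> 0) (\<gamma> t) \<le> 2 * R"
        using \<gamma> True Geo_isometry[of \<gamma> 0 t] mult_right_mono[of t 1 "dist (\<gamma> 0) (\<gamma> 1)"] by auto
      then show ?thesis
        using True \<gamma> dist_triangle[of a "\<gamma> t" "\<gamma> 0"] by (auto simp: S_def)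
    qed (use \<gamma> in \<open>auto simp: Geo_def S_def\<close>)
    then show "\<gamma> \<in> PiE UNIV S" by auto
  qed
  ultimately show ?thesis
    using compact_Int_closed[of "PiE UNIV S" ?G] by (simp only: Int_absorb1)
qed

lemma measurable_geodesic_selection:
  assumes "geodesic_space (UNIV :: 'a::heine_borel set) dist"
  shows "\<exists>\<Gamma> \<in> borel \<Otimes>\<^sub>M borel \<rightarrow>\<^sub>M Geo_borel.
    \<forall>p :: 'a \<times> 'a. \<Gamma> p \<in> Geo UNIV dist \<and> \<Gamma> p 0 = fst p \<and> \<Gamma> p 1 = snd p"
proof -
  define K where "K p = {\<gamma> \<in> Geo UNIV dist. \<gamma> 0 = fst p \<and> \<gamma> 1 = snd p}" for p :: "'a \<times> 'a"
  obtain D :: "'a set" where D: "countable D" "\<And>X. open X \<Longrightarrow> X \<noteq> {} \<Longrightarrow> \<exists>d\<in>D. d \<in> X"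
    using countable_dense_exists by metis
  have "D \<noteq> {}" using D(2)[of UNIV] by auto
  \<comment> \<open>The index \<open>n\<close> codes a pair: a point of the dense set and a rational
    time. Distances to dense points determine the values at rational times, and these determine the
    geodesic.\<close>
  define \<phi> where "\<phi> n \<gamma> = dist (from_nat_into D (fst (prod_decode n)))
      (\<gamma> (from_nat_into (\<rat> \<inter> {0..1}) (snd (prod_decode n))))" for n and \<gamma> :: "real \<Rightarrow> 'a"
  have "\<exists>f \<in> borel_measurable (borel \<Otimes>\<^sub>M borel). \<forall>p\<in>space (borel \<Otimes>\<^sub>M borel). f p \<in> K p"
  proof (rule compact_valued_measurable_selection[where \<phi> = \<phi>])
    fix p :: "'a \<times> 'a"
    have "K p = (Geo UNIV dist \<inter> {\<gamma>. \<gamma> 0 = fst p} \<inter> {\<gamma>. \<gamma> 1 = snd p})" by (auto simp: K_def)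
    also have "closed \<dots>" by (intro closed_Int closed_Geo closed_Collect_eq continuous_intros)
    finally show "closed (K p)" .
    moreover have "K p \<subseteq> {\<gamma> \<in> Geo UNIV dist. \<gamma> 0 \<in> cball (fst p) (dist (fst p) (snd p)) \<and>
          \<gamma> 1 \<in> cball (fst p) (dist (fst p) (snd p))}"
      by (auto simp: K_def)
    ultimately show "compact (K p)"
      using compact_Int_closed[OF compact_Geo_bounded_ends[of "fst p" "dist (fst p) (snd p)"], of "K p"]
      by (simp only: Int_absorb1)
    obtain \<gamma> where "\<gamma> \<in> Geo UNIV dist" "\<gamma> 0 = fst p" "\<gamma> 1 = snd p"
      using assms unfolding geodesic_space_def by (metis UNIV_I)
    then show "K p \<noteq> {}" by (auto simp: K_def)
  next
    show "continuous_on UNIV (\<phi> n)" for n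
      unfolding \<phi>_def by (intro continuous_intros)
  next
    fix p :: "'a \<times> 'a" and \<gamma> \<eta>
    assume "\<gamma> \<in> K p" "\<eta> \<in> K p" and eq: "\<And>n. \<phi> n \<gamma> = \<phi> n \<eta>"
    then have \<gamma>: "\<gamma> \<in> Geo UNIV dist" and \<eta>: "\<eta> \<in> Geo UNIV dist" by (auto simp: K_def)
    have rat: "\<gamma> q = \<eta> q" if q: "q \<in> \<rat> \<inter> {0..1}" for q
    proof (rule ccontr)
      assume "\<gamma> q \<noteq> \<eta> q"
      \<comment> \<open>Such a point is strictly closer to \<open>\<gamma> q\<close> than to
        \<open>\<eta> q\<close>, so the distances to it tell the two values apart.\<close>
      then obtain d where d: "d \<in> D" "d \<in> ball (\<gamma> q) (dist (\<gamma> q) (\<eta> q) / 2)"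
        using D(2)[of "ball (\<gamma> q) (dist (\<gamma> q) (\<eta> q) / 2)"] by auto
      obtain i where i: "from_nat_into D i = d"
        using d D(1) from_nat_into_surj by metis
      obtain j where j: "from_nat_into (\<rat> \<inter> {0..1}) j = q"
        using q from_nat_into_surj[of "\<rat> \<inter> {0..1::real}" q] countable_rat by blast
      have "dist d (\<gamma> q) = dist d (\<eta> q)"
        using eq[of "prod_encode (i, j)"] by (simp add: \<phi>_def i j)
      then show False
        using d(2) dist_triangle2[of "\<gamma> q" "\<eta> q" d] by (simp add: dist_commute)
    qed
    have "\<gamma> t = \<eta> t" if t: "t \<in> {0..1}" for t
    proof (rule ccontr)
      assume "\<gamma> t \<noteq> \<eta> t"
      \<comment> \<open>The summand 1 keeps \<open>c\<close> positive for constant geodesics. Within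
        time \<open>\<delta>\<close> the two paths together move less than their separation at
        \<open>t\<close>, although they agree at a rational time that close.\<close>
      define c where "c = dist (\<gamma> 0) (\<gamma> 1) + dist (\<eta> 0) (\<eta> 1) + 1"
      define \<delta> where "\<delta> = dist (\<gamma> t) (\<eta> t) / c"
      have c: "c > 0" by (simp add: c_def add_nonneg_pos)
      then have \<delta>: "\<delta> > 0" using \<open>\<gamma> t \<noteq> \<eta> t\<close> by (simp add: \<delta>_def)
      have "max 0 (t - \<delta>) < min 1 (t + \<delta>)" using t \<delta> by auto
      then obtain q where q: "q \<in> \<rat>" "max 0 (t - \<delta>) < q" "q < min 1 (t + \<delta>)"
        using Rats_dense_in_real by blast
      then have qI: "q \<in> {0..1}" and tq: "\<bar>t - q\<bar> < \<delta>" by auto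
      have "dist (\<gamma> t) (\<eta> t) \<le> dist (\<gamma> t) (\<gamma> q) + dist (\<eta> q) (\<eta> t)"
        using dist_triangle[of "\<gamma> t" "\<eta> t" "\<gamma> q"] rat[of q] q qI by simp
      also have "\<dots> = \<bar>t - q\<bar> * (dist (\<gamma> 0) (\<gamma> 1) + dist (\<eta> 0) (\<eta> 1))"
        unfolding Geo_isometry[OF \<gamma> t qI] Geo_isometry[OF \<eta> qI t]
        by (simp add: abs_minus_commute distrib_left)
      also have "\<dots> \<le> \<bar>t - q\<bar> * c" by (intro mult_left_mono) (auto simp: c_def)
      also have "\<dots> < \<delta> * c" using tq c by simp
      finally show False using c by (simp add: \<delta>_def)
    qed
    moreover have "\<gamma> t = \<eta> t" if "t \<notin> {0..1}" for t
      using \<gamma> \<eta> that by (auto simp: Geo_def PiE_def extensional_def)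
    ultimately show "\<gamma> = \<eta>" by blast
  next
    fix C :: "(real \<Rightarrow> 'a) set" assume C: "closed C"
    fix a :: 'a
    define G where "G R = {\<gamma> \<in> Geo UNIV dist. \<gamma> 0 \<in> cball a (real R) \<and> \<gamma> 1 \<in> cball a (real R)}" for R
    \<comment> \<open>Endpoint pairs of geodesics in \<open>C\<close> form a countable union of
      continuous images of compact sets, one for each bound \<open>R\<close> on the ends; hence an
      F-sigma set.\<close>
    have "{p \<in> space (borel \<Otimes>\<^sub>M borel). K p \<inter> C \<noteq> {}} = (\<Union>R. (\<lambda>\<gamma>. (\<gamma> 0, \<gamma> 1)) ` (G R \<inter> C))"
    proof (intro equalityI subsetI)
      fix p assume "p \<in> {p \<in> space (borel \<Otimes>\<^sub>M borel). K p \<inter> C \<noteq> {}}"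
      then obtain \<gamma> where \<gamma>: "\<gamma> \<in> K p" "\<gamma> \<in> C" by blast
      obtain R where "max (dist a (\<gamma> 0)) (dist a (\<gamma> 1)) \<le> real R" using real_arch_simple by blast
      then have "\<gamma> \<in> G R \<inter> C" "p = (\<gamma> 0, \<gamma> 1)" using \<gamma> by (auto simp: G_def K_def)
      then show "p \<in> (\<Union>R. (\<lambda>\<gamma>. (\<gamma> 0, \<gamma> 1)) ` (G R \<inter> C))" by blast
    qed (auto simp: K_def G_def space_pair_measure)
    moreover have "closed ((\<lambda>\<gamma>. (\<gamma> 0, \<gamma> 1)) ` (G R \<inter> C))" for R
      unfolding G_def using C
      by (intro compact_imp_closed compact_continuous_image continuous_intros compact_Int_closed
          compact_Geo_bounded_ends)
    ultimately show "{p \<in> space (borel \<Otimes>\<^sub>M borel). K p \<inter> C \<noteq> {}} \<in> sets (borel \<Otimes>\<^sub>M borel)"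
      unfolding borel_prod by (simp add: borel_closed sets.countable_UN)
  qed
  then obtain f where f: "f \<in> borel_measurable (borel \<Otimes>\<^sub>M borel)" "\<And>p. f p \<in> K p"
    by (auto simp: space_pair_measure)
  have "f \<in> borel \<Otimes>\<^sub>M borel \<rightarrow>\<^sub>M Geo_borel"
  proof (rule measurable_sigma_sets[OF sets_Geo_borel Geo_open_subset])
    show "f \<in> space (borel \<Otimes>\<^sub>M borel) \<rightarrow> Geo UNIV dist" using f(2) by (auto simp: K_def)
    fix U :: "(real \<Rightarrow> 'a) set" assume "U \<in> {U. openin (mtopology_of Geo_metric) U}"
    then obtain V where V: "open V" "U = V \<inter> Geo UNIV dist"
      using openin_Geo_metric_imp_product_open by blast
    have "f -` U \<inter> space (borel \<Otimes>\<^sub>M borel) = f -` V \<inter> space (borel \<Otimes>\<^sub>M borel)"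
      using V f(2) by (auto simp: K_def)
    then show "f -` U \<inter> space (borel \<Otimes>\<^sub>M borel) \<in> sets (borel \<Otimes>\<^sub>M borel)"
      using measurable_sets[OF f(1), of V] V(1) by simp
  qed
  then show ?thesis using f(2) unfolding K_def by blast
qed

section \<open>Limits of couplings\<close>

lemma couplingsD:
  assumes "\<pi> \<in> couplings \<mu> \<nu>"
  shows "prob_space \<pi>" "sets \<pi> = sets (borel \<Otimes>\<^sub>M borel)" "space \<pi> = UNIV"
    "distr \<pi> borel fst = \<mu>" "distr \<pi> borel snd = \<nu>"
  using assms sets_eq_imp_space_eq[of \<pi> "borel \<Otimes>\<^sub>M borel"]
  by (auto simp: couplings_def space_prob_algebra space_pair_measure)

lemma couplingsI:
  assumes "prob_space \<pi>" "sets \<pi> = sets (borel \<Otimes>\<^sub>M borel)"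
    "distr \<pi> borel fst = \<mu>" "distr \<pi> borel snd = \<nu>"
  shows "\<pi> \<in> couplings \<mu> \<nu>"
  using assms by (auto simp: couplings_def space_prob_algebra)

lemma measurable_couplings:
  assumes "\<pi> \<in> couplings \<mu> \<nu>"
  shows "measurable \<pi> = measurable (borel \<Otimes>\<^sub>M borel)"
  using couplingsD(2)[OF assms] by (intro ext measurable_cong_sets) auto

lemma emeasure_coupling_fst:
  assumes "\<pi> \<in> couplings \<mu> \<nu>" "A \<in> sets borel"
  shows "emeasure \<pi> (A \<times> UNIV) = emeasure \<mu> A"
proof -
  have "emeasure \<mu> A = emeasure (distr \<pi> borel fst) A" using couplingsD[OF assms(1)] by simp
  also have "\<dots> = emeasure \<pi> (fst -` A \<inter> space \<pi>)"
    using assms by (intro emeasure_distr) (auto simp: measurable_couplings[OF assms(1)])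
  also have "fst -` A \<inter> space \<pi> = A \<times> UNIV" using couplingsD(3)[OF assms(1)] by auto
  finally show ?thesis by simp
qed

lemma emeasure_coupling_snd:
  assumes "\<pi> \<in> couplings \<mu> \<nu>" "A \<in> sets borel"
  shows "emeasure \<pi> (UNIV \<times> A) = emeasure \<nu> A"
proof -
  have "emeasure \<nu> A = emeasure (distr \<pi> borel snd) A" using couplingsD[OF assms(1)] by simp
  also have "\<dots> = emeasure \<pi> (snd -` A \<inter> space \<pi>)"
    using assms by (intro emeasure_distr) (auto simp: measurable_couplings[OF assms(1)])
  also have "snd -` A \<inter> space \<pi> = UNIV \<times> A" using couplingsD(3)[OF assms(1)] by auto
  finally show ?thesis by simp
qed

text \<open>By Tychonoff the sequence has a cluster point \<open>\<beta>\<close> in a cube indexed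
  by an arbitrary set. The filter \<open>G\<close> consists of \<open>sequentially\<close> refined
  by the preimages of the neighbourhoods of \<open>\<beta>\<close>; it is proper exactly because
  \<open>\<beta>\<close> is a cluster point.\<close>

lemma exists_pointwise_limit_along_filter:
  fixes f :: "nat \<Rightarrow> 'i \<Rightarrow> real"
  assumes "\<And>n i. f n i \<in> {0..1}"
  obtains G :: "nat filter" and \<beta> where "G \<noteq> bot" "G \<le> sequentially" "\<And>i. ((\<lambda>n. f n i) \<longlongrightarrow> \<beta> i) G"
proof -
  have "compactin (product_topology (\<lambda>i. euclidean) UNIV) (PiE UNIV (\<lambda>_ :: 'i. {0..1::real}))"
    unfolding compactin_PiE by (simp add: compactin_euclidean_iff)
  then have "compact (PiE UNIV (\<lambda>_ :: 'i. {0..1::real}))"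
    unfolding euclidean_product_topology compactin_euclidean_iff .
  moreover have "filtermap f sequentially \<noteq> bot" by (simp add: filtermap_bot_iff)
  moreover have "eventually (\<lambda>x. x \<in> PiE UNIV (\<lambda>_. {0..1})) (filtermap f sequentially)"
    using assms by (simp add: eventually_filtermap PiE_def Pi_def)
  ultimately obtain \<beta> where \<beta>: "inf (nhds \<beta>) (filtermap f sequentially) \<noteq> bot"
    unfolding compact_filter by blast
  define G where "G = inf (filtercomap f (nhds \<beta>)) sequentially"
  have "G \<noteq> bot"
  proof
    assume "G = bot"
    then have "eventually (\<lambda>_. False) G" by simp
    then obtain P Q where PQ: "eventually P (nhds \<beta>)" "eventually Q sequentially" "\<And>n. P (f n) \<Longrightarrow> Q n \<Longrightarrow> False"
      unfolding G_def eventually_inf eventually_filtercomap by blast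
    then have "eventually (\<lambda>n. \<not> P (f n)) sequentially"
      by (auto intro: eventually_mono[OF PQ(2)])
    then have "eventually (\<lambda>_. False) (inf (nhds \<beta>) (filtermap f sequentially))"
      unfolding eventually_inf eventually_filtermap
      using PQ(1) by (intro exI[of _ P] exI[of _ "\<lambda>x. \<not> P x"]) auto
    then show False using \<beta> by (simp add: eventually_False)
  qed
  moreover have "(f \<longlongrightarrow> \<beta>) G"
    unfolding G_def by (rule tendsto_mono[OF inf_le1 filterlim_filtercomap])
  then have "((\<lambda>n. f n i) \<longlongrightarrow> \<beta> i) G" for i
    using continuous_on_tendsto_compose[OF continuous_on_product_coordinates] by fastforce
  ultimately show thesis by (intro that) (auto simp: G_def)
qed

lemma compact_inner_approx:
  fixes \<mu> :: "'a::polish_space measure"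
  assumes "finite_measure \<mu>" "sets \<mu> = sets borel" "A \<in> sets borel" "\<epsilon> > 0"
  obtains K where "compact K" "K \<subseteq> A" "emeasure \<mu> (A - K) \<le> ennreal \<epsilon>"
proof -
  interpret finite_measure \<mu> by fact
  have SUP: "emeasure \<mu> A = (SUP K\<in>{K. K \<subseteq> A \<and> compact K}. emeasure \<mu> K)"
    using assms emeasure_finite by (intro inner_regular) auto
  have "\<exists>K\<in>{K. K \<subseteq> A \<and> compact K}. emeasure \<mu> A < emeasure \<mu> K + ennreal \<epsilon>"
    by (rule SUP_approx_ennreal[OF assms(4) _ SUP]) auto
  then obtain K where K: "K \<subseteq> A" "compact K" "emeasure \<mu> A < emeasure \<mu> K + ennreal \<epsilon>"
    by blast
  have KS: "K \<in> sets \<mu>" using K assms borel_compact by simp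
  have "emeasure \<mu> K + emeasure \<mu> (A - K) = emeasure \<mu> A"
    using K assms KS plus_emeasure[of K \<mu> "A - K"] by (simp add: Un_absorb1)
  then have "emeasure \<mu> (A - K) \<le> ennreal \<epsilon>"
    using K(3) emeasure_finite[of K]
    by (metis ennreal_add_left_cancel_less less_imp_le)
  then show thesis using that K by blast
qed

text \<open>Setwise limits of couplings on finite unions of rectangles are countably additive there,
  because the common marginals are tight; hence they extend to a coupling.\<close>

lemma couplings_limit:
  fixes \<mu> \<nu> :: "'a::polish_space measure"
  assumes P: "\<And>n. P n \<in> couplings \<mu> \<nu>"
  obtains G :: "nat filter" and \<pi> where "G \<noteq> bot" "G \<le> sequentially" "\<pi> \<in> couplings \<mu> \<nu>"
    "\<And>A B. A \<in> sets borel \<Longrightarrow> B \<in> sets borel \<Longrightarrow>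
      ((\<lambda>n. measure (P n) (A \<times> B)) \<longlongrightarrow> measure \<pi> (A \<times> B)) G"
proof -
  have prob: "prob_space (P n)" and setsP: "sets (P n) = sets (borel \<Otimes>\<^sub>M borel)" for n
    using couplingsD[OF P] by auto
  have \<mu>: "finite_measure \<mu>" "sets \<mu> = sets borel" and \<nu>: "finite_measure \<nu>" "sets \<nu> = sets borel"
    using couplingsD[OF P[of 0]] prob_space.prob_space_distr[OF prob[of 0], of fst borel]
      prob_space.prob_space_distr[OF prob[of 0], of snd borel]
    by (auto simp: measurable_couplings[OF P[of 0]] prob_space_def)
  obtain G \<beta> where G: "G \<noteq> bot" "G \<le> sequentially"
    and \<beta>: "\<And>C. ((\<lambda>n. measure (P n) C) \<longlongrightarrow> \<beta> C) G"
    using exists_pointwise_limit_along_filter[of "\<lambda>n. measure (P n)"] prob_space.prob_le_1[OF prob]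
    by (auto simp: measure_nonneg)
  have \<beta>_le: "\<beta> C \<le> c" if "\<And>n. measure (P n) C \<le> c" for C c
    by (rule tendsto_upperbound[OF \<beta> _ G(1)]) (simp add: that)
  have \<beta>_nonneg: "0 \<le> \<beta> C" for C
    by (rule tendsto_lowerbound[OF \<beta> _ G(1)]) simp
  \<comment> \<open>Masses prescribed by the marginals do not vary with \<open>n\<close>, so the
    limit inherits them; this later identifies its marginals and its total mass.\<close>
  have \<beta>_const: "\<beta> C = c" if "\<And>n. measure (P n) C = c" for C c
    using tendsto_unique[OF G(1) \<beta>[of C], of c] by (simp add: that)
  define R :: "('a \<times> 'a) set set" where "R = {a \<times> b | a b. a \<in> sets borel \<and> b \<in> sets borel}"
  interpret R: semiring_of_sets UNIV R
  proof (unfold_locales)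
    show "R \<subseteq> Pow UNIV" by simp
    show "{} \<in> R" unfolding R_def by force
  next
    fix c d assume "c \<in> R" "d \<in> R"
    then obtain a b a' b' where ab: "c = a \<times> b" "d = a' \<times> b'"
      "a \<in> sets borel" "b \<in> sets borel" "a' \<in> sets borel" "b' \<in> sets borel"
      unfolding R_def by blast
    have "c \<inter> d = (a \<inter> a') \<times> (b \<inter> b')" using ab by auto
    then show "c \<inter> d \<in> R" unfolding R_def using ab by blast
    have "c - d = \<Union>{(a - a') \<times> b, (a \<inter> a') \<times> (b - b')}" using ab by auto
    moreover have "disjoint {(a - a') \<times> b, (a \<inter> a') \<times> (b - b')}"
      by (auto simp: disjoint_def)
    moreover have "{(a - a') \<times> b, (a \<inter> a') \<times> (b - b')} \<subseteq> R" unfolding R_def using ab by blast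
    ultimately show "\<exists>C\<subseteq>R. finite C \<and> disjoint C \<and> c - d = \<Union>C" by (metis finite.emptyI finite_insert)
  qed
  interpret Q: ring_of_sets UNIV R.generated_ring by (rule R.generating_ring)
  have sigma: "sigma_sets UNIV R.generated_ring = sets (borel \<Otimes>\<^sub>M borel)"
    unfolding R.sigma_sets_generated_ring_eq by (simp add: R_def sets_pair_measure)
  then have ring_sets: "C \<in> sets (P n)" if "C \<in> R.generated_ring" for C n
    using that setsP by auto
  have cpt_sets: "K \<in> sets (P n)" if "compact K" for K n
    unfolding setsP borel_prod using that by (rule borel_compact)
  \<comment> \<open>Uniformity in \<open>n\<close> is the point. Outside
    \<open>K \<times> K'\<close> a rectangle \<open>a \<times> b\<close> lies in two strips over
    \<open>a - K\<close> and \<open>b - K'\<close>, whose masses are those of the marginals. Each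
    strip receives \<open>\<epsilon> / 4\<close>, and the remaining rectangles
    \<open>\<epsilon> / 2\<close>.\<close>
  have approx: "\<exists>K. compact K \<and> K \<subseteq> C \<and> (\<forall>n. measure (P n) (C - K) \<le> \<epsilon>)"
    if C: "C \<in> R.generated_ring" and "\<epsilon> > 0" for C \<epsilon>
  proof -
    obtain F where F: "C = \<Union>F" "finite F" "F \<subseteq> R" using C by (auto elim: R.generated_ringE)
    show ?thesis
      unfolding F(1) using F(2,3) \<open>\<epsilon> > 0\<close>
    proof (induction arbitrary: \<epsilon>)
      case empty
      then show ?case by (intro exI[of _ "{}"]) auto
    next
      case (insert c F)
      from insert.prems have "c \<in> R" by simp
      then obtain a b where ab: "c = a \<times> b" "a \<in> sets borel" "b \<in> sets borel" unfolding R_def by blast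
      have e4: "\<epsilon> / 4 > 0" using insert.prems by simp
      obtain K where K: "compact K" "K \<subseteq> a" "emeasure \<mu> (a - K) \<le> ennreal (\<epsilon> / 4)"
        using compact_inner_approx[OF \<mu> ab(2) e4] by blast
      obtain K' where K': "compact K'" "K' \<subseteq> b" "emeasure \<nu> (b - K') \<le> ennreal (\<epsilon> / 4)"
        using compact_inner_approx[OF \<nu> ab(3) e4] by blast
      obtain H where H: "compact H" "H \<subseteq> \<Union>F" "\<And>n. measure (P n) (\<Union>F - H) \<le> \<epsilon> / 2"
        using insert.IH[of "\<epsilon> / 2"] insert.prems by auto
      have KB: "K \<in> sets borel" "K' \<in> sets borel" using K K' by (auto intro: borel_compact)
      have "measure (P n) (\<Union>(insert c F) - (K \<times> K' \<union> H)) \<le> \<epsilon>" for n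
      proof -
        interpret prob_space "P n" by (rule prob)
        have 1: "(a - K) \<times> UNIV \<in> events" "UNIV \<times> (b - K') \<in> events"
          unfolding setsP using ab KB by (auto intro!: pair_measureI)
        have "\<Union>F \<in> events"
          using insert.hyps(1) insert.prems(1)
          by (intro sets.finite_Union) (auto intro: ring_sets R.generated_ringI_Basic)
        then have 2: "\<Union>F - H \<in> events" by (rule sets.Diff[OF _ cpt_sets[OF H(1)]])
        have "emeasure (P n) ((a - K) \<times> UNIV) \<le> ennreal (\<epsilon> / 4)"
          "emeasure (P n) (UNIV \<times> (b - K')) \<le> ennreal (\<epsilon> / 4)"
          using ab KB K(3) K'(3) emeasure_coupling_fst[OF P, of "a - K" n] emeasure_coupling_snd[OF P, of "b - K'" n]
          by simp_all
        then have 3: "prob ((a - K) \<times> UNIV) \<le> \<epsilon> / 4" "prob (UNIV \<times> (b - K')) \<le> \<epsilon> / 4"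
          unfolding emeasure_eq_measure ennreal_le_iff[OF less_imp_le[OF e4]] by auto
        have "prob (\<Union>(insert c F) - (K \<times> K' \<union> H)) \<le>
            prob ((a - K) \<times> UNIV \<union> UNIV \<times> (b - K') \<union> (\<Union>F - H))"
          using 1 2 by (intro finite_measure_mono) (auto simp: ab)
        also have "\<dots> \<le> prob ((a - K) \<times> UNIV) + prob (UNIV \<times> (b - K')) + prob (\<Union>F - H)"
          using 1 2 by (intro order_trans[OF measure_Un_le] add_right_mono
             measure_Un_le sets.Un)
        finally show ?thesis using 3 H(3)[of n] by simp
      qed
      then show ?case
        using K K' H ab by (intro exI[of _ "K \<times> K' \<union> H"]) (auto intro!: compact_Times)
    qed
  qed
  have "\<exists>m :: ('a \<times> 'a) set \<Rightarrow> ennreal. (\<forall>C\<in>R.generated_ring. m C = ennreal (\<beta> C)) \<and>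
      measure_space UNIV (sigma_sets UNIV R.generated_ring) m"
  \<comment> \<open>Finite additivity survives the limit; countable additivity reduces to continuity
    at the empty set, which needs the compact approximations.\<close>
  proof (rule Q.caratheodory_empty_continuous)
    show "positive R.generated_ring (\<lambda>C. ennreal (\<beta> C))"
      using \<beta>_const[of "{}" 0] by (simp add: positive_def)
    show "additive R.generated_ring (\<lambda>C. ennreal (\<beta> C))"
      unfolding additive_def
    proof (intro ballI impI)
      fix C D assume CD: "C \<in> R.generated_ring" "D \<in> R.generated_ring" "C \<inter> D = {}"
      have "measure (P n) (C \<union> D) = measure (P n) C + measure (P n) D" for n
      proof -
        interpret prob_space "P n" by (rule prob)
        show ?thesis using CD ring_sets by (intro finite_measure_Union) auto
      qed
      then have "\<beta> (C \<union> D) = \<beta> C + \<beta> D"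
        using tendsto_unique[OF G(1) \<beta>[of "C \<union> D"], of "\<beta> C + \<beta> D"] tendsto_add[OF \<beta>[of C] \<beta>[of D]] by simp
      then show "ennreal (\<beta> (C \<union> D)) = ennreal (\<beta> C) + ennreal (\<beta> D)"
        by (simp add: \<beta>_nonneg)
    qed
    fix C :: "nat \<Rightarrow> ('a \<times> 'a) set"
    assume C: "range C \<subseteq> R.generated_ring" "decseq C" "(\<Inter>i. C i) = {}"
    have "(\<lambda>i. \<beta> (C i)) \<longlonglongrightarrow> 0"
    proof (rule LIMSEQ_I)
      fix r :: real assume r: "r > 0"
      have "\<exists>K. compact K \<and> K \<subseteq> C i \<and> (\<forall>n. measure (P n) (C i - K) \<le> r / 4 * (1/2)^i)" for i
        using C(1) r by (intro approx) auto
      then obtain K where K: "\<And>i. compact (K i)" "\<And>i. K i \<subseteq> C i"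
        and PK: "\<And>i n. measure (P n) (C i - K i) \<le> r / 4 * (1/2)^i" by metis
      \<comment> \<open>The compact sets inside the \<open>C i\<close> have empty intersection, so
        finitely many already do. Beyond the largest index \<open>N\<close>, every point of
        \<open>C k\<close> therefore lies in some \<open>C i - K i\<close> with
        \<open>i \<le> N\<close>, and these losses sum to at most \<open>r / 2\<close> for every
        \<open>n\<close>.\<close>
      have "\<exists>I. finite I \<and> K 0 \<inter> (\<Inter>i\<in>I. K i) = {}"
      proof (rule ccontr)
        assume "\<not> ?thesis"
        then have "K 0 \<inter> (\<Inter>i\<in>I. K i) \<noteq> {}" if "finite I" for I
          using that by simp
        then have "K 0 \<inter> (\<Inter>i\<in>UNIV. K i) \<noteq> {}"
          by (rule compact_imp_fip_image[OF K(1) compact_imp_closed[OF K(1)]])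
        then show False using C(3) K(2) by blast
      qed
      then obtain I where I: "finite I" "K 0 \<inter> (\<Inter>i\<in>I. K i) = {}" by blast
      define N where "N = Max (insert 0 I)"
      have N: "i \<le> N" if "i \<in> insert 0 I" for i using I that unfolding N_def by (intro Max_ge) auto
      have "\<beta> (C k) \<le> r / 2" if "k \<ge> N" for k
      proof (rule \<beta>_le)
        fix n
        interpret prob_space "P n" by (rule prob)
        have ev: "C i - K i \<in> events" for i
          using C(1) by (intro sets.Diff[OF ring_sets cpt_sets[OF K(1)]]) auto
        have "C k \<subseteq> (\<Union>i\<in>{..N}. C i - K i)"
        proof
          fix x assume x: "x \<in> C k"
          obtain i where i: "i \<in> insert 0 I" "x \<notin> K i" using I(2) by auto
          have "x \<in> C i" using decseqD[OF C(2), of i k] N[OF i(1)] that x by auto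
          then show "x \<in> (\<Union>i\<in>{..N}. C i - K i)" using i N by blast
        qed
        then have "prob (C k) \<le> prob (\<Union>i\<in>{..N}. C i - K i)"
          using ev by (intro finite_measure_mono) auto
        also have "\<dots> \<le> (\<Sum>i\<le>N. prob (C i - K i))"
          using ev by (intro measure_UNION_le) auto
        also have "\<dots> \<le> (\<Sum>i\<le>N. r / 4 * (1/2)^i)" by (intro sum_mono PK)
        also have "\<dots> = r / 4 * (\<Sum>i\<le>N. (1/2)^i)" by (simp add: sum_distrib_left)
        also have "(\<Sum>i\<le>N. (1/2::real)^i) \<le> 2"
          unfolding sum_gp0 by simp
        finally show "prob (C k) \<le> r / 2" using r by simp
      qed
      then have "norm (\<beta> (C k) - 0) < r" if "k \<ge> N" for k
        using \<beta>_nonneg[of "C k"] r that by fastforce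
      then show "\<exists>N. \<forall>k\<ge>N. norm (\<beta> (C k) - 0) < r" by blast
    qed
    then show "(\<lambda>i. ennreal (\<beta> (C i))) \<longlonglongrightarrow> 0" using tendsto_ennrealI[of "\<lambda>i. \<beta> (C i)" 0] by simp
  qed simp
  then obtain m where m: "\<And>C. C \<in> R.generated_ring \<Longrightarrow> m C = ennreal (\<beta> C)"
    and ms: "measure_space UNIV (sigma_sets UNIV R.generated_ring) m" by blast
  define \<pi> where "\<pi> = measure_of UNIV R.generated_ring m"
  have sets_\<pi>: "sets \<pi> = sets (borel \<Otimes>\<^sub>M borel)"
    by (simp add: \<pi>_def sigma)
  have space_\<pi>: "space \<pi> = UNIV" by (simp add: \<pi>_def)
  have em: "emeasure \<pi> (A \<times> B) = ennreal (\<beta> (A \<times> B))" if "A \<in> sets borel" "B \<in> sets borel" for A B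
  proof -
    have AB: "A \<times> B \<in> R.generated_ring" using that by (intro R.generated_ringI_Basic) (auto simp: R_def)
    have "emeasure \<pi> (A \<times> B) = m (A \<times> B)"
      using ms AB by (intro emeasure_measure_of[OF \<pi>_def]) (auto simp: measure_space_def \<pi>_def)
    then show ?thesis using m AB by simp
  qed
  have "\<pi> \<in> couplings \<mu> \<nu>"
  proof (rule couplingsI)
    have "\<beta> (UNIV \<times> UNIV) = 1"
      using prob_space.prob_space[OF prob] couplingsD(3)[OF P] by (intro \<beta>_const) simp
    then show "prob_space \<pi>" using em[of UNIV UNIV] space_\<pi> by (intro prob_spaceI) simp
    show "sets \<pi> = sets (borel \<Otimes>\<^sub>M borel)" by fact
    have meas[measurable]: "fst \<in> \<pi> \<rightarrow>\<^sub>M borel" "snd \<in> \<pi> \<rightarrow>\<^sub>M borel"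
      by (auto simp: measurable_cong_sets[OF sets_\<pi> refl])
    show "distr \<pi> borel fst = \<mu>"
    proof (rule measure_eqI)
      fix A assume "A \<in> sets (distr \<pi> borel fst)"
      then have A: "A \<in> sets borel" by simp
      have "emeasure (distr \<pi> borel fst) A = emeasure \<pi> (fst -` A \<inter> space \<pi>)"
        using A by (intro emeasure_distr) auto
      also have "fst -` A \<inter> space \<pi> = A \<times> UNIV" by (auto simp: space_\<pi>)
      also have "emeasure \<pi> (A \<times> UNIV) = ennreal (\<beta> (A \<times> UNIV))" using A by (intro em) auto
      also have "\<beta> (A \<times> UNIV) = measure \<mu> A"
        using emeasure_coupling_fst[OF P A] by (intro \<beta>_const) (simp add: measure_def)
      finally show "emeasure (distr \<pi> borel fst) A = emeasure \<mu> A"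
        using \<mu>(1) by (simp add: finite_measure.emeasure_eq_measure)
    qed (simp add: \<mu>)
    show "distr \<pi> borel snd = \<nu>"
    proof (rule measure_eqI)
      fix A assume "A \<in> sets (distr \<pi> borel snd)"
      then have A: "A \<in> sets borel" by simp
      have "emeasure (distr \<pi> borel snd) A = emeasure \<pi> (snd -` A \<inter> space \<pi>)"
        using A by (intro emeasure_distr) auto
      also have "snd -` A \<inter> space \<pi> = UNIV \<times> A" by (auto simp: space_\<pi>)
      also have "emeasure \<pi> (UNIV \<times> A) = ennreal (\<beta> (UNIV \<times> A))" using A by (intro em) auto
      also have "\<beta> (UNIV \<times> A) = measure \<nu> A"
        using emeasure_coupling_snd[OF P A] by (intro \<beta>_const) (simp add: measure_def)
      finally show "emeasure (distr \<pi> borel snd) A = emeasure \<nu> A"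
        using \<nu>(1) by (simp add: finite_measure.emeasure_eq_measure)
    qed (simp add: \<nu>)
  qed
  moreover have "((\<lambda>n. measure (P n) (A \<times> B)) \<longlongrightarrow> measure \<pi> (A \<times> B)) G"
    if "A \<in> sets borel" "B \<in> sets borel" for A B
    using \<beta>[of "A \<times> B"] em[OF that] by (simp add: measure_def \<beta>_nonneg)
  ultimately show thesis using that G by blast
qed

section \<open>Gluing of couplings\<close>

lemma distr_pair_in_couplings:
  assumes "prob_space M" and f: "f \<in> M \<rightarrow>\<^sub>M borel" and g: "g \<in> M \<rightarrow>\<^sub>M borel"
  shows "distr M (borel \<Otimes>\<^sub>M borel) (\<lambda>x. (f x, g x)) \<in> couplings (distr M borel f) (distr M borel g)"
proof (rule couplingsI)
  have fg: "(\<lambda>x. (f x, g x)) \<in> M \<rightarrow>\<^sub>M borel \<Otimes>\<^sub>M borel" using f g by measurable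
  show "prob_space (distr M (borel \<Otimes>\<^sub>M borel) (\<lambda>x. (f x, g x)))"
    by (rule prob_space.prob_space_distr[OF assms(1) fg])
  show "distr (distr M (borel \<Otimes>\<^sub>M borel) (\<lambda>x. (f x, g x))) borel fst = distr M borel f"
    by (subst distr_distr) (use fg in \<open>auto simp: o_def\<close>)
  show "distr (distr M (borel \<Otimes>\<^sub>M borel) (\<lambda>x. (f x, g x))) borel snd = distr M borel g"
    by (subst distr_distr) (use fg in \<open>auto simp: o_def\<close>)
qed simp

text \<open>The two points are made conditionally independent given their common label: on the block
  where both labels equal \<open>i\<close>, the product measure is divided by the mass
  \<open>m i\<close> of that label. Equal label laws give each section integral 1, hence the right
  marginals.\<close>

lemma discrete_glue:
  fixes f :: "'p \<Rightarrow> nat" and g :: "'q \<Rightarrow> nat"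
  assumes "prob_space M" "prob_space N"
    and f [measurable]: "f \<in> M \<rightarrow>\<^sub>M count_space UNIV" and g [measurable]: "g \<in> N \<rightarrow>\<^sub>M count_space UNIV"
    and eq: "distr M (count_space UNIV) f = distr N (count_space UNIV) g"
  obtains \<tau> where "prob_space \<tau>" "sets \<tau> = sets (M \<Otimes>\<^sub>M N)" "distr \<tau> M fst = M" "distr \<tau> N snd = N"
    "AE p in \<tau>. f (fst p) = g (snd p)"
proof -
  interpret M: prob_space M by fact
  interpret N: prob_space N by fact
  interpret MN: pair_prob_space M N ..
  define m where "m i = emeasure (distr M (count_space UNIV) f) {i}" for i
  have mM: "m i = emeasure M {x \<in> space M. f x = i}" for i
    unfolding m_def by (subst emeasure_distr) (auto intro!: arg_cong[where f="emeasure M"])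
  have mN: "m i = emeasure N {x \<in> space N. g x = i}" for i
    unfolding m_def eq by (subst emeasure_distr) (auto intro!: arg_cong[where f="emeasure N"])
  have m_top: "m i \<noteq> top" for i unfolding mM by simp
  \<comment> \<open>On labels of mass zero the factor \<open>1 / m i\<close> is \<open>top\<close>;
    those labels occur with probability zero.\<close>
  have AEM: "AE x in M. m (f x) \<noteq> 0"
  proof -
    have "AE x in M. m i = 0 \<longrightarrow> f x \<noteq> i" for i
      by (cases "m i = 0") (auto simp: mM AE_iff_measurable[OF _ refl])
    then have "AE x in M. \<forall>i. m i = 0 \<longrightarrow> f x \<noteq> i" by (simp add: AE_all_countable)
    then show ?thesis by eventually_elim auto
  qed
  have AEN: "AE x in N. m (g x) \<noteq> 0"
  proof -
    have "AE x in N. m i = 0 \<longrightarrow> g x \<noteq> i" for i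
      by (cases "m i = 0") (auto simp: mN AE_iff_measurable[OF _ refl])
    then have "AE x in N. \<forall>i. m i = 0 \<longrightarrow> g x \<noteq> i" by (simp add: AE_all_countable)
    then show ?thesis by eventually_elim auto
  qed
  define F where "F p = (if f (fst p) = g (snd p) then 1 / m (f (fst p)) else 0)" for p
  have f' [measurable]: "(\<lambda>p. f (fst p)) \<in> M \<Otimes>\<^sub>M N \<rightarrow>\<^sub>M count_space UNIV"
    and g' [measurable]: "(\<lambda>p. g (snd p)) \<in> M \<Otimes>\<^sub>M N \<rightarrow>\<^sub>M count_space UNIV"
    by (rule measurable_compose[OF measurable_fst f], rule measurable_compose[OF measurable_snd g])
  have [measurable]: "(\<lambda>p. 1 / m (f (fst p))) \<in> borel_measurable (M \<Otimes>\<^sub>M N)"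
    by (rule measurable_compose[OF f']) simp
  \<comment> \<open>Equality of labels is first written as a countable union of measurable
    events.\<close>
  have "Measurable.pred (M \<Otimes>\<^sub>M N) (\<lambda>p. \<exists>i. f (fst p) = i \<and> g (snd p) = i)" by measurable
  then have [measurable]: "Measurable.pred (M \<Otimes>\<^sub>M N) (\<lambda>p. f (fst p) = g (snd p))"
    by (simp add: eq_commute)
  have F [measurable]: "F \<in> borel_measurable (M \<Otimes>\<^sub>M N)"
    unfolding F_def by (intro measurable_If) auto
  define \<tau> where "\<tau> = density (M \<Otimes>\<^sub>M N) F"
  have sets_\<tau>: "sets \<tau> = sets (M \<Otimes>\<^sub>M N)" and space_\<tau>: "space \<tau> = space (M \<Otimes>\<^sub>M N)"
    by (simp_all add: \<tau>_def)
  have [measurable]: "fst \<in> \<tau> \<rightarrow>\<^sub>M M" "snd \<in> \<tau> \<rightarrow>\<^sub>M N"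
    by (auto simp: measurable_cong_sets[OF sets_\<tau> refl])
  have inner_N: "(\<integral>\<^sup>+y. F (x, y) \<partial>N) = 1" if "m (f x) \<noteq> 0" for x
  proof -
    have "(\<integral>\<^sup>+y. F (x, y) \<partial>N) = (\<integral>\<^sup>+y. 1 / m (f x) * indicator {y \<in> space N. g y = f x} y \<partial>N)"
      by (intro nn_integral_cong) (auto simp: F_def indicator_def)
    also have "\<dots> = 1 / m (f x) * m (f x)"
      unfolding mN by (rule nn_integral_cmult_indicator) measurable
    also have "\<dots> = 1"
      using that m_top[of "f x"] by (simp add: ennreal_divide_times ennreal_divide_self less_top)
    finally show ?thesis .
  qed
  have inner_M: "(\<integral>\<^sup>+x. F (x, y) \<partial>M) = 1" if "m (g y) \<noteq> 0" for y
  proof -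
    have "(\<integral>\<^sup>+x. F (x, y) \<partial>M) = (\<integral>\<^sup>+x. 1 / m (g y) * indicator {x \<in> space M. f x = g y} x \<partial>M)"
      by (intro nn_integral_cong) (auto simp: F_def indicator_def)
    also have "\<dots> = 1 / m (g y) * m (g y)"
      unfolding mM by (rule nn_integral_cmult_indicator) measurable
    also have "\<dots> = 1"
      using that m_top[of "g y"] by (simp add: ennreal_divide_times ennreal_divide_self less_top)
    finally show ?thesis .
  qed
  have fst: "distr \<tau> M fst = M"
  proof (rule measure_eqI)
    fix E assume "E \<in> sets (distr \<tau> M fst)"
    then have E [measurable]: "E \<in> sets M" by simp
    have "emeasure (distr \<tau> M fst) E = emeasure \<tau> (fst -` E \<inter> space (M \<Otimes>\<^sub>M N))"
      by (subst emeasure_distr) (auto simp: space_\<tau>)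
    also have "\<dots> = (\<integral>\<^sup>+p. F p * indicator (fst -` E \<inter> space (M \<Otimes>\<^sub>M N)) p \<partial>(M \<Otimes>\<^sub>M N))"
      unfolding \<tau>_def by (rule emeasure_density) measurable
    also have "\<dots> = (\<integral>\<^sup>+p. indicator E (fst p) * F p \<partial>(M \<Otimes>\<^sub>M N))"
      by (intro nn_integral_cong) (auto simp: indicator_def)
    also have "\<dots> = (\<integral>\<^sup>+x. \<integral>\<^sup>+y. indicator E x * F (x, y) \<partial>N \<partial>M)"
      using N.nn_integral_fst[OF borel_measurable_times_ennreal[OF
            measurable_compose[OF measurable_fst borel_measurable_indicator[OF E]] F]] by simp
    also have "\<dots> = (\<integral>\<^sup>+x. indicator E x * (\<integral>\<^sup>+y. F (x, y) \<partial>N) \<partial>M)"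
      by (intro nn_integral_cong nn_integral_cmult measurable_Pair2[OF F])
    also have "\<dots> = (\<integral>\<^sup>+x. indicator E x \<partial>M)"
      by (rule nn_integral_cong_AE, rule AE_mp[OF AEM], rule AE_I2) (simp add: inner_N)
    finally show "emeasure (distr \<tau> M fst) E = emeasure M E" by simp
  qed simp
  moreover have "distr \<tau> N snd = N"
  proof (rule measure_eqI)
    fix E assume "E \<in> sets (distr \<tau> N snd)"
    then have E [measurable]: "E \<in> sets N" by simp
    have "emeasure (distr \<tau> N snd) E = emeasure \<tau> (snd -` E \<inter> space (M \<Otimes>\<^sub>M N))"
      by (subst emeasure_distr) (auto simp: space_\<tau>)
    also have "\<dots> = (\<integral>\<^sup>+p. F p * indicator (snd -` E \<inter> space (M \<Otimes>\<^sub>M N)) p \<partial>(M \<Otimes>\<^sub>M N))"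
      unfolding \<tau>_def by (rule emeasure_density) measurable
    also have "\<dots> = (\<integral>\<^sup>+p. indicator E (snd p) * F p \<partial>(M \<Otimes>\<^sub>M N))"
      by (intro nn_integral_cong) (auto simp: indicator_def)
    also have "\<dots> = (\<integral>\<^sup>+y. \<integral>\<^sup>+x. indicator E y * F (x, y) \<partial>M \<partial>N)"
      using MN.nn_integral_snd[OF borel_measurable_times_ennreal[OF
            measurable_compose[OF measurable_snd borel_measurable_indicator[OF E]] F]] by simp
    also have "\<dots> = (\<integral>\<^sup>+y. indicator E y * (\<integral>\<^sup>+x. F (x, y) \<partial>M) \<partial>N)"
      by (intro nn_integral_cong nn_integral_cmult measurable_Pair1[OF F])
    also have "\<dots> = (\<integral>\<^sup>+y. indicator E y \<partial>N)"
      by (rule nn_integral_cong_AE, rule AE_mp[OF AEN], rule AE_I2) (simp add: inner_M)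
    finally show "emeasure (distr \<tau> N snd) E = emeasure N E" by simp
  qed simp
  moreover have "prob_space \<tau>"
    using prob_space_distrD[of fst \<tau> M] fst M.prob_space_axioms by simp
  moreover have "AE p in \<tau>. f (fst p) = g (snd p)"
    unfolding \<tau>_def by (subst AE_density) (auto simp: F_def intro!: AE_I2)
  ultimately show thesis using that sets_\<tau> by blast
qed

text \<open>Label a point by the first member of an enumerated dense set that lies within
  \<open>\<epsilon>\<close>. Points with equal labels are then less than
  \<open>2 * \<epsilon>\<close> apart.\<close>

lemma fine_discretisation:
  fixes \<epsilon> :: real
  assumes "\<epsilon> > 0"
  obtains q :: "'a::polish_space \<Rightarrow> nat" and a :: "nat \<Rightarrow> 'a"
  where "q \<in> borel \<rightarrow>\<^sub>M count_space UNIV" "\<And>x. dist (a (q x)) x < \<epsilon>"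
proof -
  obtain D :: "'a set" where D: "countable D" "\<And>X. open X \<Longrightarrow> X \<noteq> {} \<Longrightarrow> \<exists>d\<in>D. d \<in> X"
    using countable_dense_exists by metis
  define a where "a = from_nat_into D"
  define q where "q x = (LEAST i. dist (a i) x < \<epsilon>)" for x
  have "dist (a (q x)) x < \<epsilon>" for x
  proof -
    obtain d where d: "d \<in> D" "d \<in> ball x \<epsilon>" using D(2)[of "ball x \<epsilon>"] assms by auto
    then obtain i where "a i = d" using D(1) from_nat_into_surj unfolding a_def by metis
    then have "dist (a i) x < \<epsilon>" using d by (simp add: dist_commute)
    then show ?thesis unfolding q_def by (rule LeastI)
  qed
  moreover have "q \<in> borel \<rightarrow>\<^sub>M count_space UNIV"
    unfolding q_def by measurable
  ultimately show thesis using that by blast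
qed

text \<open>Fatou's lemma, packaged to carry a uniform bound on integrals to a pointwise
  limit.\<close>

lemma nn_integral_limit_le:
  fixes u :: "nat \<Rightarrow> 'p \<Rightarrow> ennreal"
  assumes "\<And>n. u n \<in> borel_measurable M" "\<And>n. (\<integral>\<^sup>+x. u n x \<partial>M) \<le> C"
    and "\<And>x. x \<in> space M \<Longrightarrow> (\<lambda>n. u n x) \<longlonglongrightarrow> v x"
  shows "(\<integral>\<^sup>+x. v x \<partial>M) \<le> C"
proof -
  have "(\<integral>\<^sup>+x. v x \<partial>M) = (\<integral>\<^sup>+x. liminf (\<lambda>n. u n x) \<partial>M)"
    using assms(3) by (intro nn_integral_cong) (metis lim_imp_Liminf sequentially_bot)
  also have "\<dots> \<le> liminf (\<lambda>n. \<integral>\<^sup>+x. u n x \<partial>M)" by (rule nn_integral_liminf) (rule assms)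
  also have "\<dots> \<le> C"
    using Liminf_mono[of "\<lambda>n. \<integral>\<^sup>+x. u n x \<partial>M" "\<lambda>_. C" sequentially] assms(2)
    by (simp add: Liminf_const)
  finally show ?thesis .
qed

section \<open>The distance \<open>w\<^sub>L\<close>\<close>

text \<open>Young functions in the sense of Orlicz spaces. For a fixed coupling, the least scale of
  cost at most 1 is the Luxemburg norm of the distance; \<open>w_L\<close> minimises this kind of
  gauge over couplings.\<close>

locale young_function =
  fixes L :: "real \<Rightarrow> real"
  assumes convex: "convex_on {0..} L"
    and mono: "mono_on {0..} L"
    and zero: "L 0 = 0"
    and pos: "r > 0 \<Longrightarrow> L r > 0"
    and cont: "continuous_on {0..} L"
begin

lemma nonneg: "r \<ge> 0 \<Longrightarrow> L r \<ge> 0"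
  using pos zero by (cases "r = 0") (auto intro: less_imp_le)

lemma mono_le: "0 \<le> r \<Longrightarrow> r \<le> s \<Longrightarrow> L r \<le> L s"
  using mono by (auto simp: mono_on_def)

text \<open>Convexity, restated as subadditivity of the perspective \<open>(c, r) \<mapsto> c * L (r / c)\<close>.\<close>

lemma perspective_add:
  assumes "c > 0" "e > 0" "r \<ge> 0" "s \<ge> 0"
  shows "(c + e) * L ((r + s) / (c + e)) \<le> c * L (r / c) + e * L (s / e)"
proof -
  have "L ((1 - e / (c + e)) *\<^sub>R (r / c) + (e / (c + e)) *\<^sub>R (s / e)) \<le>
      (1 - e / (c + e)) * L (r / c) + (e / (c + e)) * L (s / e)"
    using assms by (intro convex_onD[OF convex]) auto
  moreover have ce: "1 - e / (c + e) = c / (c + e)" using assms by (simp add: field_simps)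
  moreover have "(c / (c + e)) *\<^sub>R (r / c) + (e / (c + e)) *\<^sub>R (s / e) = (r + s) / (c + e)"
    using assms by (simp add: add_divide_distrib)
  ultimately have "L ((r + s) / (c + e)) \<le> (c * L (r / c) + e * L (s / e)) / (c + e)"
    by (simp add: add_divide_distrib)
  then show ?thesis using assms by (simp add: pos_le_divide_eq mult.commute)
qed

text \<open>Split the scale \<open>e\<close> as \<open>c + (e - c)\<close> and let the second part
  cover distance 0, which costs nothing.\<close>

lemma perspective_antimono:
  assumes "0 < c" "c \<le> e" "r \<ge> 0"
  shows "e * L (r / e) \<le> c * L (r / c)"
  using perspective_add[of c "e - c" r 0] assms by (cases "c = e") (auto simp: zero)

lemma continuous_max: "continuous_on UNIV (\<lambda>r. L (max 0 r))"
  by (rule continuous_on_compose2[OF cont]) (auto intro!: continuous_intros)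

text \<open>Nothing is known about \<open>L\<close> on negative numbers. The absolute value keeps
  the argument in the half-line, where \<open>L\<close> agrees with the continuous function
  \<open>\<lambda>r. L (max 0 r)\<close>.\<close>

lemma measurable_cost [measurable]:
  fixes c :: real
  assumes [measurable]: "f \<in> M \<rightarrow>\<^sub>M borel" "g \<in> M \<rightarrow>\<^sub>M borel"
  shows "(\<lambda>x. ennreal (L (\<bar>dist (f x) (g x :: 'a::polish_space) / c\<bar>))) \<in> borel_measurable M"
proof -
  have [measurable]: "(\<lambda>r. L (max 0 r)) \<in> borel_measurable borel"
    by (rule borel_measurable_continuous_onI[OF continuous_max])
  have "(\<lambda>x. ennreal (L (max 0 \<bar>dist (f x) (g x) / c\<bar>))) \<in> borel_measurable M" by measurable
  then show ?thesis by simp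
qed

lemma measurable_cost_pos:
  fixes c :: real
  assumes "c > 0" "f \<in> M \<rightarrow>\<^sub>M borel" "g \<in> M \<rightarrow>\<^sub>M borel"
  shows "(\<lambda>x. ennreal (L (dist (f x) (g x :: 'a::polish_space) / c))) \<in> borel_measurable M"
  using measurable_cost[OF assms(2,3), of c] assms(1) by simp

lemma measurable_cost_pair:
  fixes c :: real
  assumes "c > 0"
  shows "(\<lambda>p :: 'a::polish_space \<times> 'a. ennreal (L (dist (fst p) (snd p) / c)))
    \<in> borel_measurable (borel \<Otimes>\<^sub>M borel)"
  using assms by (intro measurable_cost_pos) auto

lemma transport_cost_distr:
  fixes f :: "'p \<Rightarrow> 'a::polish_space"
  assumes "c > 0" "f \<in> M \<rightarrow>\<^sub>M borel" "g \<in> M \<rightarrow>\<^sub>M borel"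
  shows "transport_cost L c (distr M (borel \<Otimes>\<^sub>M borel) (\<lambda>x. (f x, g x))) =
    (\<integral>\<^sup>+x. ennreal (L (dist (f x) (g x) / c)) \<partial>M)"
  unfolding transport_cost_def using assms measurable_cost_pair[OF assms(1)]
  by (subst nn_integral_distr) (auto intro: measurable_Pair)

text \<open>The inequality of \<open>perspective_antimono\<close>, integrated. The factor
  \<open>c / e\<close> improves on plain monotonicity: it makes room for couplings that are only
  almost minimal.\<close>

lemma transport_cost_scale:
  fixes \<pi> :: "('a::polish_space \<times> 'a) measure"
  assumes "0 < c" "c \<le> e" and \<pi>: "\<pi> \<in> couplings \<mu> \<nu>"
  shows "transport_cost L e \<pi> \<le> ennreal (c / e) * transport_cost L c \<pi>"
proof -
  have "transport_cost L e \<pi> \<le> (\<integral>\<^sup>+p. ennreal (c / e) * ennreal (L (dist (fst p) (snd p) / c)) \<partial>\<pi>)"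
    unfolding transport_cost_def
  proof (rule nn_integral_mono)
    fix p
    have "L (dist (fst p) (snd p) / e) \<le> c / e * L (dist (fst p) (snd p) / c)"
      using perspective_antimono[of c e "dist (fst p) (snd p)"] assms by (simp add: field_simps)
    then show "ennreal (L (dist (fst p) (snd p) / e)) \<le> ennreal (c / e) * ennreal (L (dist (fst p) (snd p) / c))"
      using assms nonneg[of "dist (fst p) (snd p) / c"] by (simp add: ennreal_mult[symmetric] ennreal_leI)
  qed
  also have "\<dots> = ennreal (c / e) * transport_cost L c \<pi>"
    unfolding transport_cost_def using measurable_cost_pair[OF assms(1)]
    by (intro nn_integral_cmult) (simp add: measurable_couplings[OF \<pi>])
  finally show ?thesis .
qed

lemma transport_cost_antimono:
  fixes \<pi> :: "('a::polish_space \<times> 'a) measure"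
  assumes "0 < c" "c \<le> e"
  shows "transport_cost L e \<pi> \<le> transport_cost L c \<pi>"
  unfolding transport_cost_def
  using assms by (intro nn_integral_mono ennreal_leI mono_le) (auto simp: frac_le)

section \<open>Admissible scales, symmetry and the triangle inequality\<close>

lemma w_L_leI:
  assumes "\<pi> \<in> couplings \<mu> \<nu>" "c > 0" "transport_cost L c \<pi> \<le> 1"
  shows "w_L L \<mu> \<nu> \<le> ennreal c"
  unfolding w_L_def using assms by (intro Inf_lower imageI CollectI conjI INF_lower2) auto

text \<open>The inner infimum need not be known to be attained. At an admissible scale
  \<open>e < c\<close> some coupling costs less than \<open>c / e\<close>, a number above 1, and
  passing to scale \<open>c\<close> multiplies its cost by at most \<open>e / c\<close>.\<close>

lemma w_L_lessD:
  fixes \<mu> \<nu> :: "'a::polish_space measure"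
  assumes "w_L L \<mu> \<nu> < ennreal c"
  obtains \<pi> where "\<pi> \<in> couplings \<mu> \<nu>" "transport_cost L c \<pi> \<le> 1"
proof -
  obtain e where e: "e > 0" "(INF \<pi>\<in>couplings \<mu> \<nu>. transport_cost L e \<pi>) \<le> 1" "ennreal e < ennreal c"
    using assms unfolding w_L_def Inf_less_iff by auto
  have ec: "e < c" using e(1,3) by (simp add: ennreal_less_iff)
  have "(1::ennreal) < ennreal (c / e)" using ec e(1) by simp
  then obtain \<pi> where \<pi>: "\<pi> \<in> couplings \<mu> \<nu>" "transport_cost L e \<pi> < ennreal (c / e)"
    using e(2) unfolding INF_less_iff[symmetric] by (meson INF_less_iff le_less_trans)
  have "transport_cost L c \<pi> \<le> ennreal (e / c) * transport_cost L e \<pi>"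
    using ec e(1) \<pi>(1) by (intro transport_cost_scale) auto
  also have "\<dots> \<le> ennreal (e / c) * ennreal (c / e)" using \<pi>(2) by (intro mult_left_mono) auto
  also have "\<dots> = 1" using ec e(1) by (simp add: ennreal_mult[symmetric])
  finally show thesis using that \<pi>(1) by blast
qed

lemma w_L_commute_le:
  fixes \<mu> \<nu> :: "'a::polish_space measure"
  shows "w_L L \<nu> \<mu> \<le> w_L L \<mu> \<nu>"
proof (rule dense_ge)
  fix z assume z: "w_L L \<mu> \<nu> < z"
  show "w_L L \<nu> \<mu> \<le> z"
  proof (cases z)
    case (real c)
    then have c: "c > 0" using z by (auto simp: ennreal_less_zero_iff zero_less_iff_neq_zero less_le)
    obtain \<pi> where \<pi>: "\<pi> \<in> couplings \<mu> \<nu>" "transport_cost L c \<pi> \<le> 1"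
      using w_L_lessD z real by blast
    have m: "fst \<in> \<pi> \<rightarrow>\<^sub>M borel" "snd \<in> \<pi> \<rightarrow>\<^sub>M borel" by (simp_all add: measurable_couplings[OF \<pi>(1)])
    have "distr \<pi> (borel \<Otimes>\<^sub>M borel) (\<lambda>p. (snd p, fst p)) \<in> couplings \<nu> \<mu>"
      using distr_pair_in_couplings[OF couplingsD(1)[OF \<pi>(1)] m(2,1)] couplingsD(4,5)[OF \<pi>(1)] by simp
    moreover have "transport_cost L c (distr \<pi> (borel \<Otimes>\<^sub>M borel) (\<lambda>p. (snd p, fst p))) \<le> 1"
      using \<pi>(2) unfolding transport_cost_distr[OF c m(2,1)] unfolding transport_cost_def[of L c \<pi>]
      by (simp add: dist_commute)
    ultimately show ?thesis using w_L_leI c real by blast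
  qed simp
qed

lemma w_L_commute:
  fixes \<mu> \<nu> :: "'a::polish_space measure"
  shows "w_L L \<mu> \<nu> = w_L L \<nu> \<mu>"
  by (intro antisym w_L_commute_le)

lemma w_L_refl:
  fixes \<mu> :: "'a::polish_space measure"
  assumes "\<mu> \<in> space (prob_algebra borel)"
  shows "w_L L \<mu> \<mu> = 0"
proof -
  have \<mu>: "prob_space \<mu>" "sets \<mu> = sets borel" using assms by (auto simp: space_prob_algebra)
  have m: "(\<lambda>x. x) \<in> \<mu> \<rightarrow>\<^sub>M borel" by (simp add: measurable_cong_sets[OF \<mu>(2) refl])
  have "distr \<mu> borel (\<lambda>x. x) = \<mu>" using \<mu>(2) by (simp add: distr_id2)
  then have c: "distr \<mu> (borel \<Otimes>\<^sub>M borel) (\<lambda>x. (x, x)) \<in> couplings \<mu> \<mu>"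
    using distr_pair_in_couplings[OF \<mu>(1) m m] by simp
  have "w_L L \<mu> \<mu> \<le> ennreal c" if "c > 0" for c
    using that by (intro w_L_leI[OF c]) (auto simp: transport_cost_distr[OF _ m m] zero)
  then have "w_L L \<mu> \<mu> \<le> 0 + ennreal e" if "e > 0" for e using that by simp
  then show ?thesis using ennreal_le_epsilon[of 0 "w_L L \<mu> \<mu>"] by simp
qed

lemma w_L_triangle:
  fixes \<mu> \<nu> \<rho> :: "'a::polish_space measure"
  shows "w_L L \<mu> \<rho> \<le> w_L L \<mu> \<nu> + w_L L \<nu> \<rho>"
proof (rule ennreal_le_epsilon)
  fix e :: real assume fin: "w_L L \<mu> \<nu> + w_L L \<nu> \<rho> < top" and e: "e > 0"
  then obtain v1 v2 where v: "w_L L \<mu> \<nu> = ennreal v1" "w_L L \<nu> \<rho> = ennreal v2" "v1 \<ge> 0" "v2 \<ge> 0"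
    by (cases "w_L L \<mu> \<nu>"; cases "w_L L \<nu> \<rho>") auto
  \<comment> \<open>The error is spent in three places: the excess of \<open>c1\<close>, the excess
    of \<open>c2\<close>, and the scale of the gap between the middle points.\<close>
  define \<delta> where "\<delta> = e / 3"
  define c1 where "c1 = v1 + \<delta>"
  define c2 where "c2 = v2 + \<delta>"
  have \<delta>: "\<delta> > 0" and c1: "c1 > 0" and c2: "c2 > 0" using e v by (auto simp: \<delta>_def c1_def c2_def)
  have "w_L L \<mu> \<nu> < ennreal c1" "w_L L \<nu> \<rho> < ennreal c2"
    using v \<delta> by (auto simp: c1_def c2_def ennreal_less_iff)
  then obtain \<pi>1 \<pi>2 where \<pi>1: "\<pi>1 \<in> couplings \<mu> \<nu>" "transport_cost L c1 \<pi>1 \<le> 1"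
    and \<pi>2: "\<pi>2 \<in> couplings \<nu> \<rho>" "transport_cost L c2 \<pi>2 \<le> 1"
    by (metis w_L_lessD)
  \<comment> \<open>By convexity and \<open>L 0 = 0\<close>, \<open>L r \<le> r * L 1\<close> for
    \<open>r \<le> 1\<close>, so this choice gives \<open>L r \<le> 1\<close>.\<close>
  define r where "r = min 1 (1 / L 1)"
  have r: "r > 0" "r \<le> 1" using pos[of 1] by (auto simp: r_def)
  have "L r \<le> r * L 1" using perspective_antimono[of 1 "1 / r" 1] r by (simp add: field_simps)
  also have "\<dots> \<le> 1" using pos[of 1] by (simp add: r_def min_def field_simps)
  finally have Lr: "L r \<le> 1" .
  \<comment> \<open>With this radius, points of one cell are at most \<open>\<delta> * r\<close>
    apart, so the middle leg at scale \<open>\<delta>\<close> costs at most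
    \<open>L r\<close>.\<close>
  obtain q :: "'a \<Rightarrow> nat" and a where q [measurable]: "q \<in> borel \<rightarrow>\<^sub>M count_space UNIV"
    and a: "\<And>x. dist (a (q x)) x < \<delta> * r / 2"
    using fine_discretisation[of "\<delta> * r / 2"] \<delta> r by (metis half_gt_zero mult_pos_pos)
  have m1 [measurable]: "fst \<in> \<pi>1 \<rightarrow>\<^sub>M borel" "snd \<in> \<pi>1 \<rightarrow>\<^sub>M borel" by (simp_all add: measurable_couplings[OF \<pi>1(1)])
  have m2 [measurable]: "fst \<in> \<pi>2 \<rightarrow>\<^sub>M borel" "snd \<in> \<pi>2 \<rightarrow>\<^sub>M borel" by (simp_all add: measurable_couplings[OF \<pi>2(1)])
  \<comment> \<open>Both label laws are the image of the shared marginal \<open>\<nu>\<close> under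
    \<open>q\<close>, as the gluing requires.\<close>
  have "distr \<pi>1 (count_space UNIV) (\<lambda>p. q (snd p)) = distr (distr \<pi>1 borel snd) (count_space UNIV) q"
    by (subst distr_distr) (auto simp: o_def)
  also have "\<dots> = distr (distr \<pi>2 borel fst) (count_space UNIV) q"
    using couplingsD(5)[OF \<pi>1(1)] couplingsD(4)[OF \<pi>2(1)] by simp
  also have "\<dots> = distr \<pi>2 (count_space UNIV) (\<lambda>p. q (fst p))"
    by (subst distr_distr) (auto simp: o_def)
  finally obtain \<tau> where \<tau>: "prob_space \<tau>" "sets \<tau> = sets (\<pi>1 \<Otimes>\<^sub>M \<pi>2)" "distr \<tau> \<pi>1 fst = \<pi>1" "distr \<tau> \<pi>2 snd = \<pi>2"
    "AE p in \<tau>. q (snd (fst p)) = q (fst (snd p))"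
    by (rule discrete_glue[OF couplingsD(1)[OF \<pi>1(1)] couplingsD(1)[OF \<pi>2(1)], rotated 2]) auto
  interpret prob_space \<tau> by fact
  have mt [measurable]: "fst \<in> \<tau> \<rightarrow>\<^sub>M \<pi>1" "snd \<in> \<tau> \<rightarrow>\<^sub>M \<pi>2" by (auto simp: measurable_cong_sets[OF \<tau>(2) refl])
  define \<Lambda> where "\<Lambda> = c1 + \<delta> + c2"
  have \<Lambda>: "\<Lambda> > 0" using c1 c2 \<delta> by (simp add: \<Lambda>_def)
  have x: "(\<lambda>p. fst (fst p)) \<in> \<tau> \<rightarrow>\<^sub>M borel" "(\<lambda>p. snd (snd p)) \<in> \<tau> \<rightarrow>\<^sub>M borel"
    "(\<lambda>p. snd (fst p)) \<in> \<tau> \<rightarrow>\<^sub>M borel" "(\<lambda>p. fst (snd p)) \<in> \<tau> \<rightarrow>\<^sub>M borel"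
    by measurable
  let ?h1 = "\<lambda>p. L (dist (fst (fst p)) (snd (fst p)) / c1)"
  let ?h2 = "\<lambda>p. L (dist (fst (snd p)) (snd (snd p)) / c2)"
  have "distr \<tau> borel (\<lambda>p. fst (fst p)) = distr (distr \<tau> \<pi>1 fst) borel fst"
    by (subst distr_distr) (auto simp: o_def)
  then have d1: "distr \<tau> borel (\<lambda>p. fst (fst p)) = \<mu>" using couplingsD(4)[OF \<pi>1(1)] \<tau>(3) by simp
  have "distr \<tau> borel (\<lambda>p. snd (snd p)) = distr (distr \<tau> \<pi>2 snd) borel snd"
    by (subst distr_distr) (auto simp: o_def)
  then have d2: "distr \<tau> borel (\<lambda>p. snd (snd p)) = \<rho>" using couplingsD(5)[OF \<pi>2(1)] \<tau>(4) by simp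
  have "(\<integral>\<^sup>+p. ennreal (?h1 p) \<partial>\<tau>) = transport_cost L c1 (distr \<tau> \<pi>1 fst)"
    unfolding transport_cost_def using measurable_cost_pos[OF c1 m1]
    by (subst nn_integral_distr) auto
  then have i1: "(\<integral>\<^sup>+p. ennreal (?h1 p) \<partial>\<tau>) \<le> 1" using \<pi>1(2) \<tau>(3) by simp
  have "(\<integral>\<^sup>+p. ennreal (?h2 p) \<partial>\<tau>) = transport_cost L c2 (distr \<tau> \<pi>2 snd)"
    unfolding transport_cost_def using measurable_cost_pos[OF c2 m2]
    by (subst nn_integral_distr) auto
  then have i2: "(\<integral>\<^sup>+p. ennreal (?h2 p) \<partial>\<tau>) \<le> 1" using \<pi>2(2) \<tau>(4) by simp
  \<comment> \<open>The perspective inequality is applied twice, to legs \<open>d1\<close>,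
    \<open>\<delta> * r\<close>, \<open>d2\<close> with scales \<open>c1\<close>,
    \<open>\<delta>\<close>, \<open>c2\<close>. The resulting weights sum to 1.\<close>
  have bound: "AE p in \<tau>. ennreal (L (dist (fst (fst p)) (snd (snd p)) / \<Lambda>)) \<le>
      ennreal (c1 / \<Lambda>) * ennreal (?h1 p) + ennreal (\<delta> / \<Lambda>) + ennreal (c2 / \<Lambda>) * ennreal (?h2 p)"
    using \<tau>(5)
  proof eventually_elim
    case (elim p)
    define d1 where "d1 = dist (fst (fst p)) (snd (fst p))"
    define d2 where "d2 = dist (fst (snd p)) (snd (snd p))"
    have "dist (snd (fst p)) (fst (snd p)) \<le> dist (a (q (snd (fst p)))) (snd (fst p)) + dist (a (q (fst (snd p)))) (fst (snd p))"
      unfolding elim by (metis dist_commute dist_triangle)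
    also have "\<dots> \<le> \<delta> * r" using a[of "snd (fst p)"] a[of "fst (snd p)"] by linarith
    finally have "dist (fst (fst p)) (snd (snd p)) \<le> d1 + \<delta> * r + d2"
      using dist_triangle[of "fst (fst p)" "snd (snd p)" "snd (fst p)"]
        dist_triangle[of "snd (fst p)" "snd (snd p)" "fst (snd p)"] unfolding d1_def d2_def by linarith
    then have "\<Lambda> * L (dist (fst (fst p)) (snd (snd p)) / \<Lambda>) \<le> \<Lambda> * L ((d1 + \<delta> * r + d2) / \<Lambda>)"
      using \<Lambda> by (intro mult_left_mono mono_le divide_right_mono) auto
    also have "\<dots> \<le> (c1 + \<delta>) * L ((d1 + \<delta> * r) / (c1 + \<delta>)) + c2 * L (d2 / c2)"
      unfolding \<Lambda>_def using c1 c2 \<delta> r by (intro perspective_add) (auto simp: d1_def d2_def)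
    also have "(c1 + \<delta>) * L ((d1 + \<delta> * r) / (c1 + \<delta>)) \<le> c1 * L (d1 / c1) + \<delta> * L (\<delta> * r / \<delta>)"
      using c1 \<delta> r by (intro perspective_add) (auto simp: d1_def)
    also have "\<delta> * L (\<delta> * r / \<delta>) \<le> \<delta>" using \<delta> Lr by simp
    finally have "L (dist (fst (fst p)) (snd (snd p)) / \<Lambda>) \<le> c1 / \<Lambda> * L (d1 / c1) + \<delta> / \<Lambda> + c2 / \<Lambda> * L (d2 / c2)"
      using \<Lambda> by (simp add: field_simps)
    moreover have "L (d1 / c1) \<ge> 0" "L (d2 / c2) \<ge> 0" using c1 c2 by (auto intro!: nonneg simp: d1_def d2_def)
    ultimately show ?case
      using c1 c2 \<delta> \<Lambda> unfolding d1_def[symmetric] d2_def[symmetric]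
      by (simp add: ennreal_mult[symmetric] ennreal_plus[symmetric] del: ennreal_plus)
  qed
  have "transport_cost L \<Lambda> (distr \<tau> (borel \<Otimes>\<^sub>M borel) (\<lambda>p. (fst (fst p), snd (snd p)))) =
      (\<integral>\<^sup>+p. ennreal (L (dist (fst (fst p)) (snd (snd p)) / \<Lambda>)) \<partial>\<tau>)"
    by (rule transport_cost_distr[OF \<Lambda> x(1,2)])
  also have "\<dots> \<le> (\<integral>\<^sup>+p. ennreal (c1 / \<Lambda>) * ennreal (?h1 p) + ennreal (\<delta> / \<Lambda>) + ennreal (c2 / \<Lambda>) * ennreal (?h2 p) \<partial>\<tau>)"
    by (rule nn_integral_mono_AE[OF bound])
  also have "\<dots> = ennreal (c1 / \<Lambda>) * (\<integral>\<^sup>+p. ennreal (?h1 p) \<partial>\<tau>) + ennreal (\<delta> / \<Lambda>) + ennreal (c2 / \<Lambda>) * (\<integral>\<^sup>+p. ennreal (?h2 p) \<partial>\<tau>)"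
    using measurable_cost_pos[OF c1 x(1,3)] measurable_cost_pos[OF c2 x(4,2)] emeasure_space_1
    by (simp add: nn_integral_add nn_integral_cmult)
  also have "\<dots> \<le> ennreal (c1 / \<Lambda>) * 1 + ennreal (\<delta> / \<Lambda>) + ennreal (c2 / \<Lambda>) * 1"
    by (intro add_mono mult_left_mono i1 i2) auto
  also have "\<dots> = ennreal ((c1 + \<delta> + c2) / \<Lambda>)"
    using c1 c2 \<delta> \<Lambda> by (simp add: ennreal_plus[symmetric] add_divide_distrib del: ennreal_plus)
  also have "\<dots> = 1" using \<Lambda> by (simp add: \<Lambda>_def)
  finally have "w_L L \<mu> \<rho> \<le> ennreal \<Lambda>"
    using distr_pair_in_couplings[OF \<tau>(1) x(1,2)] \<Lambda> unfolding d1 d2 by (intro w_L_leI)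
  also have "\<dots> = w_L L \<mu> \<nu> + w_L L \<nu> \<rho> + ennreal e"
    using v e unfolding \<Lambda>_def c1_def c2_def \<delta>_def
    by (simp add: ennreal_plus[symmetric] algebra_simps del: ennreal_plus)
  finally show "w_L L \<mu> \<rho> \<le> w_L L \<mu> \<nu> + w_L L \<nu> \<rho> + ennreal e" .
qed

text \<open>Lower semicontinuity of the cost: the distance is bounded below by a function that is constant
  on the rectangles \<open>{q = i} \<times> {q = j}\<close>.\<close>

lemma transport_cost_limit_le:
  fixes P :: "nat \<Rightarrow> ('a::polish_space \<times> 'a) measure"
  assumes "c > 0" and P: "\<And>n. P n \<in> couplings \<mu> \<nu>" and \<pi>: "\<pi> \<in> couplings \<mu> \<nu>"
    and "G \<noteq> bot"
    and lim: "\<And>A B. A \<in> sets borel \<Longrightarrow> B \<in> sets borel \<Longrightarrow>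
      ((\<lambda>n. measure (P n) (A \<times> B)) \<longlongrightarrow> measure \<pi> (A \<times> B)) G"
    and ev: "eventually (\<lambda>n. transport_cost L c (P n) \<le> 1) G"
  shows "transport_cost L c \<pi> \<le> 1"
proof -
  have "\<exists>q a. q \<in> borel \<rightarrow>\<^sub>M count_space (UNIV :: nat set) \<and> (\<forall>x :: 'a. dist (a (q x)) x < 1 / real (Suc k))" for k
    by (rule fine_discretisation[of "1 / real (Suc k)"]) auto
  then obtain q a where q: "\<And>k. q k \<in> borel \<rightarrow>\<^sub>M count_space (UNIV :: nat set)"
    and a: "\<And>k (x::'a). dist (a k (q k x)) x < 1 / real (Suc k)"
    by metis
  define A where "A k i = {x. q k x = i}" for k i
  have A: "A k i \<in> sets borel" for k i
    using measurable_sets[OF q, of "{i}" k] by (simp add: A_def vimage_def)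
  \<comment> \<open>Replacing two points by the centres of their cells changes their distance by at
    most \<open>2 / real (Suc k)\<close>; this is subtracted, and \<open>max 0\<close> keeps the
    result where \<open>L\<close> is monotone.\<close>
  define D where "D k i j = max 0 (dist (a k i) (a k j) - 2 / real (Suc k)) / c" for k i j
  have D_nonneg: "D k i j \<ge> 0" for k i j using \<open>c > 0\<close> by (simp add: D_def)
  have D_close: "\<bar>dist (a k (q k x)) (a k (q k y)) - dist x y\<bar> \<le> 2 / real (Suc k)" for k x y
    using a[of k x] a[of k y] dist_triangle[of "a k (q k x)" "a k (q k y)" x] dist_triangle[of x "a k (q k y)" y]
      dist_triangle[of x y "a k (q k x)"] dist_triangle[of "a k (q k x)" y "a k (q k y)"]
    by (auto simp: dist_commute abs_le_iff)
  have D_le: "D k (q k x) (q k y) \<le> dist x y / c" for k x y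
    unfolding D_def using D_close[of k x y] \<open>c > 0\<close> by (intro divide_right_mono) auto
  \<comment> \<open>Truncation to \<open>N\<close> labels turns the integral into a finite sum of
    rectangle masses, to which the setwise limits apply.\<close>
  define s where "s k N p = (\<Sum>i<N. \<Sum>j<N. ennreal (L (D k i j)) * indicator (A k i \<times> A k j) p)" for k N and p :: "'a \<times> 'a"
  have s_eq: "s k N (x, y) = (if q k x < N \<and> q k y < N then ennreal (L (D k (q k x) (q k y))) else 0)" for k N x y
  proof -
    have "s k N (x, y) = (\<Sum>i<N. \<Sum>j<N. if j = q k y then if i = q k x then ennreal (L (D k i j)) else 0 else 0)"
      unfolding s_def by (intro sum.cong) (auto simp: A_def indicator_def)
    also have "\<dots> = (\<Sum>i<N. if i = q k x then if q k y < N then ennreal (L (D k i (q k y))) else 0 else 0)"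
      by (intro sum.cong) (auto simp: sum.delta)
    also have "\<dots> = (if q k x < N \<and> q k y < N then ennreal (L (D k (q k x) (q k y))) else 0)"
      by (auto simp: sum.delta)
    finally show ?thesis .
  qed
  have AA: "A k i \<times> A k j \<in> sets \<rho>" if "\<rho> \<in> couplings \<mu> \<nu>" for \<rho> k i j
    using couplingsD(2)[OF that] A by auto
  have s_meas: "s k N \<in> borel_measurable \<rho>" if "\<rho> \<in> couplings \<mu> \<nu>" for \<rho> k N
    unfolding s_def[abs_def]
    by (intro borel_measurable_sum borel_measurable_times_ennreal borel_measurable_const
        borel_measurable_indicator AA[OF that])
  have s_int: "(\<integral>\<^sup>+p. s k N p \<partial>\<rho>) = ennreal (\<Sum>i<N. \<Sum>j<N. L (D k i j) * measure \<rho> (A k i \<times> A k j))"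
    if "\<rho> \<in> couplings \<mu> \<nu>" for \<rho> k N
  proof -
    interpret prob_space \<rho> by (rule couplingsD(1)[OF that])
    have "(\<integral>\<^sup>+p. s k N p \<partial>\<rho>) =
        (\<Sum>i<N. \<integral>\<^sup>+p. (\<Sum>j<N. ennreal (L (D k i j)) * indicator (A k i \<times> A k j) p) \<partial>\<rho>)"
      unfolding s_def by (rule nn_integral_sum)
        (intro borel_measurable_sum borel_measurable_times_ennreal borel_measurable_const
          borel_measurable_indicator AA[OF that])
    also have "\<dots> = (\<Sum>i<N. \<Sum>j<N. \<integral>\<^sup>+p. ennreal (L (D k i j)) * indicator (A k i \<times> A k j) p \<partial>\<rho>)"
      by (intro sum.cong refl nn_integral_sum borel_measurable_times_ennreal borel_measurable_const
          borel_measurable_indicator AA[OF that])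
    also have "\<dots> = (\<Sum>i<N. \<Sum>j<N. ennreal (L (D k i j)) * emeasure \<rho> (A k i \<times> A k j))"
      by (intro sum.cong refl nn_integral_cmult_indicator AA[OF that])
    finally have "(\<integral>\<^sup>+p. s k N p \<partial>\<rho>) = \<dots>" .
    then show ?thesis
      using nonneg[OF D_nonneg] by (simp add: emeasure_eq_measure ennreal_mult sum_nonneg flip: sum_ennreal)
  qed
  have s_le: "(\<integral>\<^sup>+p. s k N p \<partial>\<pi>) \<le> 1" for k N
  proof -
    have "((\<lambda>n. \<Sum>i<N. \<Sum>j<N. L (D k i j) * measure (P n) (A k i \<times> A k j)) \<longlongrightarrow>
        (\<Sum>i<N. \<Sum>j<N. L (D k i j) * measure \<pi> (A k i \<times> A k j))) G"
      by (intro tendsto_intros lim A)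
    moreover have "eventually (\<lambda>n. (\<Sum>i<N. \<Sum>j<N. L (D k i j) * measure (P n) (A k i \<times> A k j)) \<le> 1) G"
      using ev
    proof eventually_elim
      case (elim n)
      have "(\<integral>\<^sup>+p. s k N p \<partial>P n) \<le> transport_cost L c (P n)"
        unfolding transport_cost_def
      proof (rule nn_integral_mono)
        fix p :: "'a \<times> 'a"
        show "s k N p \<le> ennreal (L (dist (fst p) (snd p) / c))"
          using s_eq[of k N "fst p" "snd p"] mono_le[OF D_nonneg D_le, of k "fst p" "snd p"]
          by (auto intro: ennreal_leI)
      qed
      then have "(\<integral>\<^sup>+p. s k N p \<partial>P n) \<le> 1" using elim by (rule order_trans)
      then show ?case unfolding s_int[OF P] by simp
    qed
    ultimately have "(\<Sum>i<N. \<Sum>j<N. L (D k i j) * measure \<pi> (A k i \<times> A k j)) \<le> 1"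
      by (rule tendsto_upperbound) fact
    then show ?thesis unfolding s_int[OF \<pi>] by simp
  qed
  \<comment> \<open>Two limits follow, both by Fatou: here all cells are included, and afterwards
    the mesh tends to zero.\<close>
  have h_le: "(\<integral>\<^sup>+p. ennreal (L (D k (q k (fst p)) (q k (snd p)))) \<partial>\<pi>) \<le> 1" for k
  proof (rule nn_integral_limit_le[OF s_meas[OF \<pi>, of k] s_le[of k]])
    fix p :: "'a \<times> 'a"
    have "eventually (\<lambda>N. s k N p = ennreal (L (D k (q k (fst p)) (q k (snd p))))) sequentially"
      using eventually_gt_at_top[of "max (q k (fst p)) (q k (snd p))"]
      by eventually_elim (use s_eq[of k _ "fst p" "snd p"] in auto)
    then show "(\<lambda>N. s k N p) \<longlonglongrightarrow> ennreal (L (D k (q k (fst p)) (q k (snd p))))"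
      by (rule tendsto_eventually)
  qed
  show ?thesis
    unfolding transport_cost_def
  proof (rule nn_integral_limit_le[OF _ h_le])
    fix k
    have "(\<lambda>p. q k (fst p)) \<in> \<pi> \<rightarrow>\<^sub>M count_space UNIV" "(\<lambda>p. q k (snd p)) \<in> \<pi> \<rightarrow>\<^sub>M count_space UNIV"
      unfolding measurable_couplings[OF \<pi>] using q
      by (auto intro: measurable_compose[OF measurable_fst] measurable_compose[OF measurable_snd])
    then have "(\<lambda>p. (q k (fst p), q k (snd p))) \<in> \<pi> \<rightarrow>\<^sub>M count_space UNIV \<Otimes>\<^sub>M count_space UNIV"
      by (rule measurable_Pair)
    moreover have "(\<lambda>ij. ennreal (L (D k (fst ij) (snd ij)))) \<in>
        borel_measurable (count_space UNIV \<Otimes>\<^sub>M count_space UNIV)"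
      by (simp add: pair_measure_countable)
    ultimately show "(\<lambda>p. ennreal (L (D k (q k (fst p)) (q k (snd p))))) \<in> borel_measurable \<pi>"
      by (auto dest: measurable_compose)
  next
    fix p :: "'a \<times> 'a"
    obtain x y where p: "p = (x, y)" by (cases p)
    have *: "(\<lambda>k. 2 / real (Suc k)) \<longlonglongrightarrow> 0"
      using tendsto_mult[OF tendsto_const[of 2] LIMSEQ_inverse_real_of_nat] by (simp add: divide_inverse)
    have "(\<lambda>k. dist (a k (q k x)) (a k (q k y)) - dist x y) \<longlonglongrightarrow> 0"
      by (rule Lim_null_comparison[OF _ *]) (use D_close in auto)
    then have lim_d: "(\<lambda>k. dist (a k (q k x)) (a k (q k y))) \<longlonglongrightarrow> dist x y" by (simp add: LIM_zero_iff)
    have "(\<lambda>k. D k (q k x) (q k y)) \<longlonglongrightarrow> max 0 (dist x y - 0) / c"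
      unfolding D_def using \<open>c > 0\<close> by (intro tendsto_divide tendsto_max tendsto_const tendsto_diff lim_d *) auto
    then have "(\<lambda>k. L (max 0 (D k (q k x) (q k y)))) \<longlonglongrightarrow> L (max 0 (max 0 (dist x y - 0) / c))"
      by (rule continuous_on_tendsto_compose[OF continuous_max]) auto
    then have "(\<lambda>k. L (D k (q k x) (q k y))) \<longlonglongrightarrow> L (dist x y / c)"
      using D_nonneg \<open>c > 0\<close> by (simp add: max_def)
    then show "(\<lambda>k. ennreal (L (D k (q k (fst p)) (q k (snd p))))) \<longlonglongrightarrow> ennreal (L (dist (fst p) (snd p) / c))"
      unfolding p by (auto intro: tendsto_ennrealI)
  qed
qed

text \<open>One coupling serves all scales above the distance: for fixed \<open>c > v\<close>, the
  scales \<open>v + 1 / real (Suc n)\<close> eventually fall below \<open>c\<close>, so almost all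
  couplings of the sequence cost at most 1 at \<open>c\<close>, and lower semicontinuity
  applies.\<close>

lemma exists_minimising_coupling:
  fixes \<mu> \<nu> :: "'a::polish_space measure"
  assumes "w_L L \<mu> \<nu> < \<infinity>"
  obtains \<pi> where "\<pi> \<in> couplings \<mu> \<nu>"
    "\<And>c. c > 0 \<Longrightarrow> w_L L \<mu> \<nu> < ennreal c \<Longrightarrow> transport_cost L c \<pi> \<le> 1"
proof -
  obtain v where v: "v \<ge> 0" "w_L L \<mu> \<nu> = ennreal v" using assms by (cases "w_L L \<mu> \<nu>") auto
  have "\<exists>\<pi>\<in>couplings \<mu> \<nu>. transport_cost L (v + 1 / real (Suc n)) \<pi> \<le> 1" for n
    using w_L_lessD[of \<mu> \<nu> "v + 1 / real (Suc n)"] v by (metis add_strict_left_mono add.right_neutral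
        ennreal_less_iff of_nat_0_less_iff zero_less_Suc zero_less_divide_1_iff)
  then obtain P where P: "\<And>n. P n \<in> couplings \<mu> \<nu>" "\<And>n. transport_cost L (v + 1 / real (Suc n)) (P n) \<le> 1"
    by metis
  have "\<exists>G \<pi>. G \<noteq> bot \<and> G \<le> sequentially \<and> \<pi> \<in> couplings \<mu> \<nu> \<and> (\<forall>A\<in>sets borel. \<forall>B\<in>sets borel.
      ((\<lambda>n. measure (P n) (A \<times> B)) \<longlongrightarrow> measure \<pi> (A \<times> B)) G)"
    by (rule couplings_limit[where P = P, OF P(1)]) blast
  then obtain G \<pi> where G: "G \<noteq> bot" "G \<le> sequentially" and \<pi>: "\<pi> \<in> couplings \<mu> \<nu>"
    and lim: "\<And>A B. A \<in> sets borel \<Longrightarrow> B \<in> sets borel \<Longrightarrow>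
      ((\<lambda>n. measure (P n) (A \<times> B)) \<longlongrightarrow> measure \<pi> (A \<times> B)) G"
    by blast
  have "transport_cost L c \<pi> \<le> 1" if c: "c > 0" "w_L L \<mu> \<nu> < ennreal c" for c
  proof (rule transport_cost_limit_le[OF c(1) P(1) \<pi> G(1) lim])
    have "v < c" using c v by (simp add: ennreal_less_iff)
    then obtain N where N: "1 / real (Suc N) < c - v" using nat_approx_posE[of "c - v"] by auto
    have "transport_cost L c (P n) \<le> 1" if "n \<ge> N" for n
    proof -
      have "1 / real (Suc n) \<le> 1 / real (Suc N)" using that by (intro divide_left_mono) auto
      then have "v + 1 / real (Suc n) \<le> c" using N by linarith
      then show ?thesis
        using P(2)[of n] transport_cost_antimono[of "v + 1 / real (Suc n)" c "P n"] v(1)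
        by (meson add_nonneg_pos of_nat_0_less_iff order_trans zero_less_Suc zero_less_divide_1_iff)
    qed
    then have "eventually (\<lambda>n. transport_cost L c (P n) \<le> 1) sequentially"
      unfolding eventually_sequentially by blast
    then show "eventually (\<lambda>n. transport_cost L c (P n) \<le> 1) G" by (rule filter_leD[OF G(2)])
  qed
  then show thesis using that \<pi> by blast
qed

text \<open>A minimising coupling costs at most 1 at every scale \<open>c\<close>, hence at most
  \<open>c\<close> at scale 1 for \<open>c \<le> 1\<close>. Its cost at scale 1 is thus 0, and
  positivity of \<open>L\<close> concentrates it on the diagonal.\<close>

lemma w_L_zero_imp_eq:
  fixes \<mu> \<nu> :: "'a::polish_space measure"
  assumes "w_L L \<mu> \<nu> = 0"
  shows "\<mu> = \<nu>"
proof -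
  obtain \<pi> where \<pi>: "\<pi> \<in> couplings \<mu> \<nu>" and cost: "\<And>c. c > 0 \<Longrightarrow> transport_cost L c \<pi> \<le> 1"
    using exists_minimising_coupling[of \<mu> \<nu>] assms by (auto simp: ennreal_less_zero_iff)
  have "transport_cost L 1 \<pi> \<le> 0 + ennreal c" if "c > 0" for c
  proof (cases "c \<le> 1")
    case True
    have "transport_cost L 1 \<pi> \<le> ennreal (c / 1) * transport_cost L c \<pi>"
      using True that \<pi> by (intro transport_cost_scale)
    also have "\<dots> \<le> ennreal c * 1" using cost[OF that] by (intro mult_mono) auto
    finally show ?thesis by simp
  next
    case False
    then have "(1::ennreal) \<le> ennreal c" by simp
    then show ?thesis using cost[of 1] by (simp add: order_trans)
  qed
  then have "transport_cost L 1 \<pi> = 0" using ennreal_le_epsilon[of 0 "transport_cost L 1 \<pi>"] by simp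
  then have "AE p in \<pi>. ennreal (L (dist (fst p) (snd p) / 1)) = 0"
    unfolding transport_cost_def using measurable_cost_pair[of 1]
    by (subst (asm) nn_integral_0_iff_AE) (auto simp: measurable_couplings[OF \<pi>])
  then have "AE p in \<pi>. fst p = snd p"
  proof eventually_elim
    case (elim p)
    then have "L (dist (fst p) (snd p)) \<le> 0" by (simp add: ennreal_eq_0_iff)
    then show ?case using pos[of "dist (fst p) (snd p)"] by (cases "fst p = snd p") auto
  qed
  then have "distr \<pi> borel fst = distr \<pi> borel snd"
    by (intro distr_cong_AE) (auto simp: measurable_couplings[OF \<pi>])
  then show ?thesis using couplingsD(4,5)[OF \<pi>] by simp
qed

lemma exists_geodesic_lift:
  fixes \<mu>\<^sub>0 \<mu>\<^sub>1 :: "'a::heine_borel measure"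
  assumes geo: "geodesic_space (UNIV :: 'a set) dist" and fin: "w_L L \<mu>\<^sub>0 \<mu>\<^sub>1 < \<infinity>"
  obtains \<Theta> where "\<Theta> \<in> space (prob_algebra Geo_borel)"
    "distr \<Theta> borel (\<lambda>\<gamma>. \<gamma> 0) = \<mu>\<^sub>0" "distr \<Theta> borel (\<lambda>\<gamma>. \<gamma> 1) = \<mu>\<^sub>1"
    "\<And>s t. s \<in> {0..1} \<Longrightarrow> t \<in> {0..1} \<Longrightarrow>
      w_L L (distr \<Theta> borel (\<lambda>\<gamma>. \<gamma> s)) (distr \<Theta> borel (\<lambda>\<gamma>. \<gamma> t)) = ennreal \<bar>s - t\<bar> * w_L L \<mu>\<^sub>0 \<mu>\<^sub>1"
proof -
  obtain v where v: "v \<ge> 0" "w_L L \<mu>\<^sub>0 \<mu>\<^sub>1 = ennreal v" using fin by (cases "w_L L \<mu>\<^sub>0 \<mu>\<^sub>1") auto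
  obtain \<pi> where \<pi>: "\<pi> \<in> couplings \<mu>\<^sub>0 \<mu>\<^sub>1"
    and cost: "\<And>c. c > 0 \<Longrightarrow> w_L L \<mu>\<^sub>0 \<mu>\<^sub>1 < ennreal c \<Longrightarrow> transport_cost L c \<pi> \<le> 1"
    using exists_minimising_coupling[OF fin] by metis
  obtain \<Gamma> where \<Gamma>: "\<Gamma> \<in> borel \<Otimes>\<^sub>M borel \<rightarrow>\<^sub>M Geo_borel"
    and ends: "\<And>p :: 'a \<times> 'a. \<Gamma> p \<in> Geo UNIV dist" "\<And>p. \<Gamma> p 0 = fst p" "\<And>p. \<Gamma> p 1 = snd p"
    using measurable_geodesic_selection[OF geo] by blast
  have \<Gamma>\<pi>: "\<Gamma> \<in> \<pi> \<rightarrow>\<^sub>M Geo_borel" using \<Gamma> by (simp add: measurable_couplings[OF \<pi>])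
  interpret \<pi>: prob_space \<pi> by (rule couplingsD(1)[OF \<pi>])
  define \<Theta> where "\<Theta> = distr \<pi> Geo_borel \<Gamma>"
  define \<mu> where "\<mu> t = distr \<Theta> borel (\<lambda>\<gamma>. \<gamma> t)" for t
  have \<mu>: "\<mu> t = distr \<pi> borel (\<lambda>p. \<Gamma> p t)" if "t \<in> {0..1}" for t
    unfolding \<mu>_def \<Theta>_def using measurable_Geo_eval[OF that] \<Gamma>\<pi> by (subst distr_distr) (auto simp: o_def)
  have m: "(\<lambda>p. \<Gamma> p t) \<in> \<pi> \<rightarrow>\<^sub>M borel" if "t \<in> {0..1}" for t
    by (rule measurable_compose[OF \<Gamma>\<pi> measurable_Geo_eval[OF that]])
  have \<mu>0: "\<mu> 0 = \<mu>\<^sub>0" and \<mu>1: "\<mu> 1 = \<mu>\<^sub>1"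
    using couplingsD(4,5)[OF \<pi>] by (simp_all add: \<mu> ends)
  have prob: "\<mu> t \<in> space (prob_algebra borel)" if "t \<in> {0..1}" for t
    unfolding \<mu>[OF that] using \<pi>.prob_space_distr[OF m[OF that]] by (simp add: space_prob_algebra)
  have upper: "w_L L (\<mu> s) (\<mu> t) \<le> ennreal (\<bar>s - t\<bar> * v)" if s: "s \<in> {0..1}" and t: "t \<in> {0..1}" for s t
  proof (cases "s = t")
    case True
    then show ?thesis using w_L_refl[OF prob[OF t]] by simp
  next
    case False
    show ?thesis
    proof (rule ennreal_le_epsilon)
      fix e :: real assume e: "e > 0"
      \<comment> \<open>Chosen so that \<open>\<bar>s - t\<bar> * c\<close> exceeds
        \<open>\<bar>s - t\<bar> * v\<close> by exactly \<open>e\<close>.\<close>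
      define c where "c = v + e / \<bar>s - t\<bar>"
      have c: "c > 0" "v < c" using e v False by (auto simp: c_def add_nonneg_pos)
      have st: "\<bar>s - t\<bar> * c > 0" using c False by simp
      have "transport_cost L (\<bar>s - t\<bar> * c) (distr \<pi> (borel \<Otimes>\<^sub>M borel) (\<lambda>p. (\<Gamma> p s, \<Gamma> p t))) =
          (\<integral>\<^sup>+p. ennreal (L (dist (\<Gamma> p s) (\<Gamma> p t) / (\<bar>s - t\<bar> * c))) \<partial>\<pi>)"
        by (rule transport_cost_distr[OF st m[OF s] m[OF t]])
      also have "\<dots> = transport_cost L c \<pi>"
        unfolding transport_cost_def Geo_isometry[OF ends(1) s t] ends(2,3) using False by simp
      also have "\<dots> \<le> 1" using cost c v by (simp add: ennreal_less_iff)
      finally have "w_L L (\<mu> s) (\<mu> t) \<le> ennreal (\<bar>s - t\<bar> * c)"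
        using distr_pair_in_couplings[OF \<pi>.prob_space_axioms m[OF s] m[OF t]] st
        unfolding \<mu>[OF s] \<mu>[OF t] by (intro w_L_leI)
      also have "\<bar>s - t\<bar> * c = \<bar>s - t\<bar> * v + e" using False by (simp add: c_def distrib_left)
      finally show "w_L L (\<mu> s) (\<mu> t) \<le> ennreal (\<bar>s - t\<bar> * v) + ennreal e"
        using v e by (simp add: ennreal_plus)
    qed
  qed
  \<comment> \<open>The legs from 0 to \<open>s\<close> and from \<open>t\<close> to 1 use at most
    \<open>(s + (1 - t)) * v\<close> of the total \<open>v\<close>; the rest is left to the middle
    leg. Its finiteness permits the subtraction.\<close>
  have le: "ennreal ((t - s) * v) \<le> w_L L (\<mu> s) (\<mu> t)" if "0 \<le> s" "s \<le> t" "t \<le> 1" for s t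
  proof -
    have st: "s \<in> {0..1}" "t \<in> {0..1}" using that by auto
    obtain u where u: "u \<ge> 0" "w_L L (\<mu> s) (\<mu> t) = ennreal u"
      using upper[OF st] by (cases "w_L L (\<mu> s) (\<mu> t)") (auto simp: top_unique)
    have "ennreal v \<le> w_L L (\<mu> 0) (\<mu> s) + (w_L L (\<mu> s) (\<mu> t) + w_L L (\<mu> t) (\<mu> 1))"
      using w_L_triangle[of "\<mu> 0" "\<mu> 1" "\<mu> s"] w_L_triangle[of "\<mu> s" "\<mu> 1" "\<mu> t"]
      unfolding v(2)[symmetric] \<mu>0 \<mu>1 by (meson add_left_mono order_trans)
    also have "\<dots> \<le> ennreal (s * v) + (ennreal u + ennreal ((1 - t) * v))"
      using upper[of 0 s] upper[of t 1] that by (intro add_mono) (auto simp: u)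
    also have "\<dots> = ennreal (s * v + (u + (1 - t) * v))" using v u that by (simp add: ennreal_plus)
    finally have "v \<le> s * v + (u + (1 - t) * v)" using v u that by (subst (asm) ennreal_le_iff) auto
    then show ?thesis using u by (simp add: algebra_simps)
  qed
  have eq: "w_L L (\<mu> s) (\<mu> t) = ennreal \<bar>s - t\<bar> * w_L L \<mu>\<^sub>0 \<mu>\<^sub>1" if s: "s \<in> {0..1}" and t: "t \<in> {0..1}" for s t
  proof -
    have "ennreal (\<bar>s - t\<bar> * v) \<le> w_L L (\<mu> s) (\<mu> t)"
    proof (cases "s \<le> t")
      case True
      then show ?thesis using le[of s t] s t by simp
    next
      case False
      then show ?thesis using le[of t s] s t by (simp add: w_L_commute[of "\<mu> s"])
    qed
    then have "w_L L (\<mu> s) (\<mu> t) = ennreal (\<bar>s - t\<bar> * v)" using upper[OF s t] by (rule antisym[rotated])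
    then show ?thesis using v by (simp add: ennreal_mult)
  qed
  have "\<Theta> \<in> space (prob_algebra Geo_borel)"
    using \<pi>.prob_space_distr[OF \<Gamma>\<pi>] by (simp add: \<Theta>_def space_prob_algebra)
  then show thesis using that \<mu>0 \<mu>1 eq unfolding \<mu>_def by blast
qed

section \<open>The metric space \<open>P_L\<close> and its geodesics\<close>

lemma w_L_P_L_finite:
  fixes x\<^sub>0 :: "'a::polish_space"
  assumes "\<mu> \<in> P_L L x\<^sub>0" "\<nu> \<in> P_L L x\<^sub>0"
  shows "w_L L \<mu> \<nu> < \<infinity>"
proof -
  have "w_L L \<mu> \<nu> \<le> w_L L \<mu> (return borel x\<^sub>0) + w_L L \<nu> (return borel x\<^sub>0)"
    using w_L_triangle[of \<mu> \<nu> "return borel x\<^sub>0"] w_L_commute[of \<nu>] by simp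
  also have "\<dots> < \<infinity>" using assms by (simp add: P_L_def)
  finally show ?thesis .
qed

lemma P_L_I:
  fixes x\<^sub>0 :: "'a::polish_space"
  assumes "\<mu> \<in> P_L L x\<^sub>0" "\<nu> \<in> space (prob_algebra borel)" "w_L L \<mu> \<nu> < \<infinity>"
  shows "\<nu> \<in> P_L L x\<^sub>0"
proof -
  have "w_L L \<nu> (return borel x\<^sub>0) \<le> w_L L \<mu> \<nu> + w_L L \<mu> (return borel x\<^sub>0)"
    using w_L_triangle[of \<nu> "return borel x\<^sub>0" \<mu>] w_L_commute[of \<nu>] by simp
  also have "\<dots> < \<infinity>" using assms by (simp add: P_L_def)
  finally show ?thesis using assms by (simp add: P_L_def)
qed

lemma Metric_space_P_L:
  fixes x\<^sub>0 :: "'a::polish_space"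
  shows "Metric_space (P_L L x\<^sub>0) (w_L_dist L)"
proof
  show "0 \<le> w_L_dist L \<mu> \<nu>" for \<mu> \<nu> :: "'a measure" by (simp add: w_L_dist_def)
  show "w_L_dist L \<mu> \<nu> = w_L_dist L \<nu> \<mu>" for \<mu> \<nu> :: "'a measure" by (simp add: w_L_dist_def w_L_commute)
next
  fix \<mu> \<nu> assume \<mu>\<nu>: "\<mu> \<in> P_L L x\<^sub>0" "\<nu> \<in> P_L L x\<^sub>0"
  then show "w_L_dist L \<mu> \<nu> = 0 \<longleftrightarrow> \<mu> = \<nu>"
    using w_L_zero_imp_eq[of \<mu> \<nu>] w_L_refl[of \<mu>] w_L_P_L_finite[OF \<mu>\<nu>]
    by (auto simp: w_L_dist_def P_L_def enn2real_eq_0_iff)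
next
  fix \<mu> \<nu> \<rho> assume *: "\<mu> \<in> P_L L x\<^sub>0" "\<nu> \<in> P_L L x\<^sub>0" "\<rho> \<in> P_L L x\<^sub>0"
  have "enn2real (w_L L \<mu> \<rho>) \<le> enn2real (w_L L \<mu> \<nu> + w_L L \<nu> \<rho>)"
    using w_L_P_L_finite[OF *(1,2)] w_L_P_L_finite[OF *(2,3)] by (intro enn2real_mono w_L_triangle) auto
  also have "\<dots> = enn2real (w_L L \<mu> \<nu>) + enn2real (w_L L \<nu> \<rho>)"
    using w_L_P_L_finite[OF *(1,2)] w_L_P_L_finite[OF *(2,3)] by (intro enn2real_plus) auto
  finally show "w_L_dist L \<mu> \<rho> \<le> w_L_dist L \<mu> \<nu> + w_L_dist L \<nu> \<rho>" by (simp add: w_L_dist_def)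
qed

lemma geodesic_space_P_L:
  fixes x\<^sub>0 :: "'a::heine_borel"
  assumes "geodesic_space (UNIV :: 'a set) dist"
  shows "geodesic_space (P_L L x\<^sub>0) (w_L_dist L)"
  unfolding geodesic_space_def
proof (intro conjI ballI Metric_space_P_L)
  fix \<mu>\<^sub>0 \<mu>\<^sub>1 assume P: "\<mu>\<^sub>0 \<in> P_L L x\<^sub>0" "\<mu>\<^sub>1 \<in> P_L L x\<^sub>0"
  have fin: "w_L L \<mu>\<^sub>0 \<mu>\<^sub>1 < \<infinity>" by (rule w_L_P_L_finite[OF P])
  obtain \<Theta> where \<Theta>: "\<Theta> \<in> space (prob_algebra Geo_borel)"
    and ends: "distr \<Theta> borel (\<lambda>\<gamma>. \<gamma> 0) = \<mu>\<^sub>0" "distr \<Theta> borel (\<lambda>\<gamma>. \<gamma> 1) = \<mu>\<^sub>1"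
    and eq: "\<And>s t. s \<in> {0..1} \<Longrightarrow> t \<in> {0..1} \<Longrightarrow>
      w_L L (distr \<Theta> borel (\<lambda>\<gamma>. \<gamma> s)) (distr \<Theta> borel (\<lambda>\<gamma>. \<gamma> t)) = ennreal \<bar>s - t\<bar> * w_L L \<mu>\<^sub>0 \<mu>\<^sub>1"
    using exists_geodesic_lift[OF assms fin] by metis
  have \<Theta>': "prob_space \<Theta>" "sets \<Theta> = sets Geo_borel" using \<Theta> by (auto simp: space_prob_algebra)
  \<comment> \<open>Members of \<open>Geo\<close> are extensional, so the curve is cut off outside
    the unit interval.\<close>
  define \<mu> where "\<mu> = restrict (\<lambda>t. distr \<Theta> borel (\<lambda>\<gamma>. \<gamma> t)) {0..1}"
  have "\<mu> t \<in> P_L L x\<^sub>0" if t: "t \<in> {0..1}" for t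
  proof (rule P_L_I[OF P(1)])
    have "(\<lambda>\<gamma>. \<gamma> t) \<in> \<Theta> \<rightarrow>\<^sub>M borel"
      using measurable_Geo_eval[OF t] by (simp add: measurable_cong_sets[OF \<Theta>'(2) refl])
    from prob_space.prob_space_distr[OF \<Theta>'(1) this] t show "\<mu> t \<in> space (prob_algebra borel)"
      by (simp add: \<mu>_def space_prob_algebra)
    show "w_L L \<mu>\<^sub>0 (\<mu> t) < \<infinity>"
      using eq[of 0 t] t fin by (simp add: \<mu>_def ends ennreal_mult_less_top)
  qed
  moreover have "w_L_dist L (\<mu> s) (\<mu> t) = \<bar>s - t\<bar> * w_L_dist L (\<mu> 0) (\<mu> 1)" if "s \<in> {0..1}" "t \<in> {0..1}" for s t
    using that eq[OF that] by (simp add: \<mu>_def w_L_dist_def ends enn2real_mult)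
  moreover have "\<mu> \<in> extensional {0..1}" by (simp add: \<mu>_def)
  ultimately have "\<mu> \<in> Geo (P_L L x\<^sub>0) (w_L_dist L)"
    unfolding Geo_def PiE_def by blast
  moreover have "\<mu> 0 = \<mu>\<^sub>0" "\<mu> 1 = \<mu>\<^sub>1" by (simp_all add: \<mu>_def ends)
  ultimately show "\<exists>\<gamma>\<in>Geo (P_L L x\<^sub>0) (w_L_dist L). \<gamma> 0 = \<mu>\<^sub>0 \<and> \<gamma> 1 = \<mu>\<^sub>1" by blast
qed

end

text \<open>Positivity: strict convexity between 0 and \<open>r\<close> gives
  \<open>L (r / 2) < L r / 2\<close>, and the left side is nonnegative. Continuity, up to the
  boundary point 0, comes from \<open>L\<close> being an indefinite integral.\<close>

lemma young_functionI:
  assumes sc: "strictly_convex_on {0..} L" and "mono_on {0..} L" and nonneg: "\<forall>r\<ge>0. L r \<ge> 0"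
    and zero: "L 0 = 0" and int: "\<forall>r\<ge>0. (l has_integral L r) {0..r}"
  shows "young_function L"
proof
  have le: "L ((1 - t) * x + t * y) \<le> (1 - t) * L x + t * L y"
    if "x \<ge> 0" "y \<ge> 0" "0 < t" "t < 1" for x y t
    using sc that unfolding strictly_convex_on_def
    by (cases "x = y") (force simp: algebra_simps intro: less_imp_le)+
  show "convex_on {0..} L"
    using le by (intro convex_onI) auto
  show "L r > 0" if "r > 0" for r
  proof -
    have "\<forall>x\<in>{0..}. \<forall>y\<in>{0..}. \<forall>t\<in>{0<..<1}. x \<noteq> y \<longrightarrow> L ((1 - t) * x + t * y) < (1 - t) * L x + t * L y"
      using sc by (simp add: strictly_convex_on_def)
    from this[rule_format, of 0 r "1/2"] that have "L (r / 2) < L r / 2" by (simp add: zero)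
    moreover have "L (r / 2) \<ge> 0" using nonneg that by simp
    ultimately show ?thesis by simp
  qed
  have "continuous_on {0..b} L" if "b \<ge> 0" for b
  proof -
    have "l integrable_on {0..b}" using int that by blast
    then have "continuous_on {0..b} (\<lambda>x. integral {0..x} l)" by (rule indefinite_integral_continuous_1)
    moreover have "integral {0..x} l = L x" if "x \<in> {0..b}" for x using int that by (intro integral_unique) auto
    ultimately show ?thesis by (rule continuous_on_eq)
  qed
  then have "continuous (at x within {0..}) L" if "x \<ge> 0" for x
  proof -
    have "continuous (at x within {0..x + 1}) L"
      using \<open>\<And>b. b \<ge> 0 \<Longrightarrow> continuous_on {0..b} L\<close>[of "x + 1"] that
      by (auto simp: continuous_on_eq_continuous_within)
    moreover have "at x within {0..x + 1} = at x within {0..}"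
      by (rule at_within_nhd[of _ "{..<x + 1}"]) auto
    ultimately show ?thesis by simp
  qed
  then show "continuous_on {0..} L" by (auto simp: continuous_on_eq_continuous_within)
qed fact+

theorem propositionA6:
  fixes x\<^sub>0 :: "'a::heine_borel"
    and L l :: "real \<Rightarrow> real"
  assumes "strictly_convex_on {0..} L"
    and "mono_on {0..} L"
    and "\<forall>r\<ge>0. L r \<ge> 0"
    and "L 0 = 0"
    and "\<forall>r\<ge>0. (l has_integral L r) {0..r}"
    and "\<forall>s>0. l s > 0"
    and "mono_on {0<..} l"
    and "(l \<longlongrightarrow> 0) (at_right 0)"
    and "geodesic_space (UNIV :: 'a set) dist"
  shows "(\<forall>\<mu>\<^sub>0 \<in> P_L L x\<^sub>0. \<forall>\<mu>\<^sub>1 \<in> P_L L x\<^sub>0. \<forall>\<pi>. optimal_coupling L \<mu>\<^sub>0 \<mu>\<^sub>1 \<pi> \<longrightarrow>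
           (\<exists>\<Theta> \<in> space (prob_algebra Geo_borel).
              distr \<Theta> borel (\<lambda>\<gamma>. \<gamma> 0) = \<mu>\<^sub>0 \<and>
              distr \<Theta> borel (\<lambda>\<gamma>. \<gamma> 1) = \<mu>\<^sub>1 \<and>
              (\<forall>s\<in>{0..1}. \<forall>t\<in>{0..1}.
                 w_L L (distr \<Theta> borel (\<lambda>\<gamma>. \<gamma> s)) (distr \<Theta> borel (\<lambda>\<gamma>. \<gamma> t)) =
                 ennreal \<bar>s - t\<bar> * w_L L \<mu>\<^sub>0 \<mu>\<^sub>1))) \<and>
         geodesic_space (P_L L x\<^sub>0) (w_L_dist L)"
proof -
  interpret young_function L by (rule young_functionI) fact+
  \<comment> \<open>Membership in \<open>P_L\<close> enters through finiteness of the distance,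
    obtained by passing through the point mass at \<open>x\<^sub>0\<close>.\<close>
  have "\<exists>\<Theta> \<in> space (prob_algebra Geo_borel).
      distr \<Theta> borel (\<lambda>\<gamma>. \<gamma> 0) = \<mu>\<^sub>0 \<and> distr \<Theta> borel (\<lambda>\<gamma>. \<gamma> 1) = \<mu>\<^sub>1 \<and>
      (\<forall>s\<in>{0..1}. \<forall>t\<in>{0..1}.
        w_L L (distr \<Theta> borel (\<lambda>\<gamma>. \<gamma> s)) (distr \<Theta> borel (\<lambda>\<gamma>. \<gamma> t)) = ennreal \<bar>s - t\<bar> * w_L L \<mu>\<^sub>0 \<mu>\<^sub>1)"
    if "\<mu>\<^sub>0 \<in> P_L L x\<^sub>0" "\<mu>\<^sub>1 \<in> P_L L x\<^sub>0" for \<mu>\<^sub>0 \<mu>\<^sub>1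
    using exists_geodesic_lift[OF assms(9) w_L_P_L_finite[OF that]] by metis
  then show ?thesis using geodesic_space_P_L[OF assms(9)] by blast
qed

end
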